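(* Let $(M,\varphi,\xi,\eta,g)$ be an almost contact B-metric manifold with Levi-Civita connection $\nabla$ of $g$, let $D$ be the Schouten-van Kampen connection associated to $\nabla$ and adapted to $(\mathcal{H},\mathcal{V})$, with potential $Q$, torsion $T$ and vertical components $Q^v$, $T^v$, and let $S(x)=-\nabla_x\xi$, $S^{\diamond}(x,y)=g(S(x),y)$. Put $\mathcal{U}_1=\mathcal{F}_1\oplus\mathcal{F}_2\oplus\mathcal{F}_3\oplus\mathcal{F}_{10}$. The following equivalences are valid. (i) The following are equivalent: $\nabla\eta$ is symmetric; $\eta$ is closed, i.e. $\mathrm{d}\eta=0$; $Q^v$ is symmetric; $T^v$ vanishes; $S$ is self-adjoint regarding $g$; $S^{\diamond}$ is symmetric; $(M,\varphi,\xi,\eta,g)\in\mathcal{U}_1\oplus\mathcal{F}_4\oplus\mathcal{F}_5\oplus\mathcal{F}_6\oplus\mathcal{F}_9$. (ii) The following are equivalent: $\nabla\eta$ is skew-symmetric; $\xi$ is Killing with respect to $g$, i.e. $\mathcal{L}_{\xi}g=0$; $Q^v$ is skew-symmetric; $S$ is anti-self-adjoint regarding $g$; $S^{\diamond}$ is skew-symmetric; $(M,\varphi,\xi,\eta,g)\in\mathcal{U}_1\oplus\mathcal{F}_7\oplus\mathcal{F}_8$. (iii) The following are equivalent: $\nabla\eta=0$; $\mathrm{d}\eta=\mathcal{L}_{\xi}g=0$; $\nabla\xi=0$; $S=0$; $S^{\diamond}=0$; $D=\nabla$; $(M,\varphi,\xi,\eta,g)\in\mathcal{U}_1$.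
   Context: An almost contact B-metric manifold $(M,\varphi,\xi,\eta,g)$ is a smooth $(2n+1)$-dimensional manifold ($n\ge 1$) with an endomorphism $\varphi$ of $TM$, a vector field $\xi$, a 1-form $\eta$ and a pseudo-Riemannian metric $g$ of signature $(n+1,n)$ such that $\varphi\xi=0$, $\varphi^2=-\mathrm{Id}+\eta\otimes\xi$, $\eta\circ\varphi=0$, $\eta(\xi)=1$, and $g(\varphi x,\varphi y)=-g(x,y)+\eta(x)\eta(y)$. Put $\mathcal{H}=\ker\eta$, $\mathcal{V}=\mathrm{span}(\xi)$, $x^h=x-\eta(x)\xi$, $x^v=\eta(x)\xi$. The Schouten-van Kampen connection associated to $\nabla$ and adapted to $(\mathcal{H},\mathcal{V})$ is $D_xy=(\nabla_xy^h)^h+(\nabla_xy^v)^v$. Its potential is $Q(x,y)=D_xy-\nabla_xy=-\eta(y)\nabla_x\xi+(\nabla_x\eta)(y)\xi$, its torsion is $T(x,y)=D_xy-D_yx-[x,y]=\eta(x)\nabla_y\xi-\eta(y)\nabla_x\xi+\mathrm{d}\eta(x,y)\xi$, and their vertical components are $Q^v(x,y)=(\nabla_x\eta)(y)\xi$ and $T^v(x,y)=\mathrm{d}\eta(x,y)\xi$, with $\mathrm{d}\eta(x,y)=(\nabla_x\eta)(y)-(\nabla_y\eta)(x)$. The tensor $\nabla\eta$ is the bilinear form $(x,y)\mapsto(\nabla_x\eta)(y)$. The shape operator $S(x)=-\nabla_x\xi$ is defined for all $x\in TM$ and takes values in $\mathcal{H}$; $\mathcal{L}$ is the Lie derivative.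 Classes: let $F(x,y,z)=g((\nabla_x\varphi)y,z)$. At each point $F$ lies in the vector space of $(0,3)$-tensors satisfying $F(x,y,z)=F(x,z,y)=F(x,\varphi y,\varphi z)+\eta(y)F(x,\xi,z)+\eta(z)F(x,y,\xi)$. Let $\theta(z)=g^{ij}F(e_i,e_j,z)$, $\theta^*(z)=g^{ij}F(e_i,\varphi e_j,z)$, where $\{e_1,\dots,e_{2n}\}$ is a basis of $\ker\eta$ at the point and $(g^{ij})$ is the inverse of $(g(e_i,e_j))$; $\mathfrak{S}_{x,y,z}$ denotes the cyclic sum. Each of the following conditions (for all $x,y,z$) defines a linear subspace, called a basic class: - $\mathcal{F}_1$: $F(x,y,z)=\frac{1}{2n}\{g(x,\varphi y)\theta(\varphi z)+g(\varphi x,\varphi y)\theta(\varphi^2z)+g(x,\varphi z)\theta(\varphi y)+g(\varphi x,\varphi z)\theta(\varphi^2y)\}$; - $\mathcal{F}_2$: $F(\xi,y,z)=F(x,\xi,z)=0$, $\mathfrak{S}_{x,y,z}F(x,y,\varphi z)=0$, $\theta=0$; - $\mathcal{F}_3$: $F(\xi,y,z)=F(x,\xi,z)=0$, $\mathfrak{S}_{x,y,z}F(x,y,z)=0$; - $\mathcal{F}_4$: $F(x,y,z)=-\frac{1}{2n}\theta(\xi)\{g(\varphi x,\varphi y)\eta(z)+g(\varphi x,\varphi z)\eta(y)\}$; - $\mathcal{F}_5$: $F(x,y,z)=-\frac{1}{2n}\theta^*(\xi)\{g(x,\varphi y)\eta(z)+g(x,\varphi z)\eta(y)\}$; - $\mathcal{F}_6,\dots,\mathcal{F}_9$: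 in each case $F(x,y,z)=F(x,y,\xi)\eta(z)+F(x,z,\xi)\eta(y)$ and, respectively, $\mathcal{F}_6$: $F(x,y,\xi)=F(y,x,\xi)=-F(\varphi x,\varphi y,\xi)$, $\theta=\theta^*=0$; $\mathcal{F}_7$: $F(x,y,\xi)=-F(y,x,\xi)=-F(\varphi x,\varphi y,\xi)$; $\mathcal{F}_8$: $F(x,y,\xi)=F(y,x,\xi)=F(\varphi x,\varphi y,\xi)$; $\mathcal{F}_9$: $F(x,y,\xi)=-F(y,x,\xi)=F(\varphi x,\varphi y,\xi)$; - $\mathcal{F}_{10}$: $F(x,y,z)=F(\xi,\varphi y,\varphi z)\eta(x)$. A manifold belongs to ($\in$) a direct sum of basic classes if at every point $F$ lies in the direct sum of the corresponding subspaces. *)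

theory Defs
  imports "HOL-Analysis.Analysis"
begin

section \<open>Smooth maps between Euclidean spaces\<close>

text \<open>The set is meant to be open: derivatives are taken with respect to the full
  neighbourhood filter.\<close>

primrec Ck_on :: "nat \<Rightarrow> 'a::euclidean_space set \<Rightarrow> ('a \<Rightarrow> 'b::real_normed_vector) \<Rightarrow> bool" where
  "Ck_on 0 S f \<longleftrightarrow> continuous_on S f"
| "Ck_on (Suc k) S f \<longleftrightarrow>
     (\<forall>u\<in>S. f differentiable (at u)) \<and> (\<forall>v. Ck_on k S (\<lambda>u. frechet_derivative f (at u) v))"

definition smooth_on :: "'a::euclidean_space set \<Rightarrow> ('a \<Rightarrow> 'b::real_normed_vector) \<Rightarrow> bool" where
  "smooth_on S f \<longleftrightarrow> (\<forall>k. Ck_on k S f)"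


section \<open>Smooth manifolds\<close>

text \<open>A manifold is a Hausdorff, second countable type \<open>'m\<close> with a smooth atlas modelled on a
  Euclidean space \<open>'e\<close>. A chart is a pair consisting of its domain and its coordinate map.\<close>

type_synonym ('m, 'e) chart = "'m set \<times> ('m \<Rightarrow> 'e)"

abbreviation chart_inv :: "('m, 'e) chart \<Rightarrow> 'e \<Rightarrow> 'm" where
  "chart_inv c \<equiv> inv_into (fst c) (snd c)"

definition smooth_atlas ::
    "('m::{t2_space,second_countable_topology}, 'e::euclidean_space) chart set \<Rightarrow> bool" where
  "smooth_atlas A \<longleftrightarrow>
     (\<Union>c\<in>A. fst c) = UNIV \<and>
     (\<forall>c\<in>A. open (fst c) \<and> open (snd c ` fst c) \<and>
            homeomorphism (fst c) (snd c ` fst c) (snd c) (chart_inv c)) \<and>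
     (\<forall>c\<in>A. \<forall>d\<in>A. smooth_on (snd c ` (fst c \<inter> fst d)) (snd d \<circ> chart_inv c))"

text \<open>The tangent space at a point \<open>p\<close> is represented by the model space \<open>'e\<close>: a vector of \<open>'e\<close>
  stands for the tangent vector at \<open>p\<close> having these components in the chart \<open>chart_at A p\<close>,
  which is selected once and for all from the charts around \<open>p\<close>. Components of a tangent vector at
  \<open>q\<close> in two charts \<open>c\<close>, \<open>d\<close> around \<open>q\<close> are related by the derivative of the transition map.\<close>

definition chart_at :: "('m, 'e) chart set \<Rightarrow> 'm \<Rightarrow> ('m, 'e) chart" where
  "chart_at A p = (SOME c. c \<in> A \<and> p \<in> fst c)"

definition coord_change ::
    "('m, 'e::euclidean_space) chart \<Rightarrow> ('m, 'e) chart \<Rightarrow> 'm \<Rightarrow> 'e \<Rightarrow> 'e" where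
  "coord_change c d q = frechet_derivative (snd d \<circ> chart_inv c) (at (snd c q))"

text \<open>A scalar function and a vector field, read in the chart \<open>chart_at A p\<close>.\<close>

definition fun_rep :: "('m, 'e::euclidean_space) chart set \<Rightarrow> 'm \<Rightarrow> ('m \<Rightarrow> real) \<Rightarrow> 'e \<Rightarrow> real" where
  "fun_rep A p f = f \<circ> chart_inv (chart_at A p)"

definition vec_rep :: "('m, 'e::euclidean_space) chart set \<Rightarrow> 'm \<Rightarrow> ('m \<Rightarrow> 'e) \<Rightarrow> 'e \<Rightarrow> 'e" where
  "vec_rep A p X = (\<lambda>u. let q = chart_inv (chart_at A p) u
                        in coord_change (chart_at A q) (chart_at A p) q (X q))"

text \<open>Smoothness \<^emph>\<open>on a neighbourhood\<close> of \<open>p\<close>. A function or vector field that is only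
  defined near \<open>p\<close> is represented by any total function extending it.\<close>

definition smooth_near ::
    "('m, 'e::euclidean_space) chart set \<Rightarrow> 'm \<Rightarrow> ('e \<Rightarrow> 'b::real_normed_vector) \<Rightarrow> bool" where
  "smooth_near A p r \<longleftrightarrow>
     (\<exists>V. open V \<and> V \<subseteq> snd (chart_at A p) ` fst (chart_at A p) \<and> snd (chart_at A p) p \<in> V \<and>
          smooth_on V r)"

definition smooth_fun_at :: "('m, 'e::euclidean_space) chart set \<Rightarrow> 'm \<Rightarrow> ('m \<Rightarrow> real) \<Rightarrow> bool" where
  "smooth_fun_at A p f \<longleftrightarrow> smooth_near A p (fun_rep A p f)"

definition smooth_vec_at :: "('m, 'e::euclidean_space) chart set \<Rightarrow> 'm \<Rightarrow> ('m \<Rightarrow> 'e) \<Rightarrow> bool" where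
  "smooth_vec_at A p X \<longleftrightarrow> smooth_near A p (vec_rep A p X)"

text \<open>The derivative \<open>x f\<close> of a function \<open>f\<close> by a tangent vector \<open>x\<close> at \<open>p\<close>.\<close>

definition vderiv :: "('m, 'e::euclidean_space) chart set \<Rightarrow> 'm \<Rightarrow> 'e \<Rightarrow> ('m \<Rightarrow> real) \<Rightarrow> real" where
  "vderiv A p x f = frechet_derivative (fun_rep A p f) (at (snd (chart_at A p) p)) x"

text \<open>In coordinates, \<open>[X, Y]\<^sup>k = X\<^sup>i \<partial>\<^sub>i Y\<^sup>k - Y\<^sup>i \<partial>\<^sub>i X\<^sup>k\<close>.\<close>

definition lie_bracket ::
    "('m, 'e::euclidean_space) chart set \<Rightarrow> ('m \<Rightarrow> 'e) \<Rightarrow> ('m \<Rightarrow> 'e) \<Rightarrow> 'm \<Rightarrow> 'e" where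
  "lie_bracket A X Y p =
     frechet_derivative (vec_rep A p Y) (at (snd (chart_at A p) p)) (X p) -
     frechet_derivative (vec_rep A p X) (at (snd (chart_at A p) p)) (Y p)"

text \<open>The vector field near \<open>p\<close> with constant components \<open>y\<close> in the chart \<open>chart_at A p\<close>:
  a smooth extension of the tangent vector \<open>y\<close> at \<open>p\<close>.\<close>

definition coord_field :: "('m, 'e::euclidean_space) chart set \<Rightarrow> 'm \<Rightarrow> 'e \<Rightarrow> 'm \<Rightarrow> 'e" where
  "coord_field A p y = (\<lambda>q. coord_change (chart_at A p) (chart_at A q) q y)"


section \<open>Almost contact B-metric manifolds\<close>

record ('m, 'e) acb_structure =
  atlas :: "('m, 'e) chart set"
  phi :: "'m \<Rightarrow> 'e \<Rightarrow> 'e"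
  xi :: "'m \<Rightarrow> 'e"
  eta :: "'m \<Rightarrow> 'e \<Rightarrow> real"
  gtensor :: "'m \<Rightarrow> 'e \<Rightarrow> 'e \<Rightarrow> real"

definition has_signature :: "('e::euclidean_space \<Rightarrow> 'e \<Rightarrow> real) \<Rightarrow> nat \<Rightarrow> nat \<Rightarrow> bool" where
  "has_signature b r s \<longleftrightarrow>
     (\<exists>P N. finite P \<and> finite N \<and> P \<inter> N = {} \<and> card P = r \<and> card N = s \<and>
            independent (P \<union> N) \<and> span (P \<union> N) = UNIV \<and>
            (\<forall>x\<in>P. b x x = 1) \<and> (\<forall>x\<in>N. b x x = -1) \<and>
            (\<forall>x\<in>P \<union> N. \<forall>y\<in>P \<union> N. x \<noteq> y \<longrightarrow> b x y = 0))"

text \<open>Smoothness of tensor fields is expressed by their action on smooth vector fields.\<close>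

definition acb_manifold ::
    "nat \<Rightarrow> ('m::{t2_space,second_countable_topology}, 'e::euclidean_space) acb_structure \<Rightarrow> bool" where
  "acb_manifold n M \<longleftrightarrow>
     DIM('e) = 2 * n + 1 \<and> smooth_atlas (atlas M) \<and>
     (\<forall>p. linear (phi M p)) \<and>
     (\<forall>p X. smooth_vec_at (atlas M) p X \<longrightarrow> smooth_vec_at (atlas M) p (\<lambda>q. phi M q (X q))) \<and>
     (\<forall>p. smooth_vec_at (atlas M) p (xi M)) \<and>
     (\<forall>p. linear (eta M p)) \<and>
     (\<forall>p X. smooth_vec_at (atlas M) p X \<longrightarrow> smooth_fun_at (atlas M) p (\<lambda>q. eta M q (X q))) \<and>
     (\<forall>p x. linear (gtensor M p x)) \<and>
     (\<forall>p x y. gtensor M p x y = gtensor M p y x) \<and>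
     (\<forall>p. has_signature (gtensor M p) (n + 1) n) \<and>
     (\<forall>p X Y. smooth_vec_at (atlas M) p X \<longrightarrow> smooth_vec_at (atlas M) p Y \<longrightarrow>
        smooth_fun_at (atlas M) p (\<lambda>q. gtensor M q (X q) (Y q))) \<and>
     (\<forall>p. phi M p (xi M p) = 0) \<and>
     (\<forall>p x. phi M p (phi M p x) = - x + eta M p x *\<^sub>R xi M p) \<and>
     (\<forall>p x. eta M p (phi M p x) = 0) \<and>
     (\<forall>p. eta M p (xi M p) = 1) \<and>
     (\<forall>p x y. gtensor M p (phi M p x) (phi M p y) = - gtensor M p x y + eta M p x * eta M p y)"


section \<open>The Levi-Civita connection and the Schouten-van Kampen connection\<close>

text \<open>\<open>nab p x Y\<close> is the covariant derivative of the vector field \<open>Y\<close> by the tangent vector \<open>x\<close>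
  at \<open>p\<close>. It is meaningful for vector fields that are smooth near \<open>p\<close>; a connection
  extends uniquely from global to such local vector fields, and its locality is a consequence
  of the Leibniz rule for functions that are smooth near \<open>p\<close>.\<close>

type_synonym ('m, 'e) connection = "'m \<Rightarrow> 'e \<Rightarrow> ('m \<Rightarrow> 'e) \<Rightarrow> 'e"

definition affine_connection ::
    "('m, 'e::euclidean_space) chart set \<Rightarrow> ('m, 'e) connection \<Rightarrow> bool" where
  "affine_connection A nab \<longleftrightarrow>
     (\<forall>p Y. smooth_vec_at A p Y \<longrightarrow> linear (\<lambda>x. nab p x Y)) \<and>
     (\<forall>p x Y Z. smooth_vec_at A p Y \<longrightarrow> smooth_vec_at A p Z \<longrightarrow>
        nab p x (\<lambda>q. Y q + Z q) = nab p x Y + nab p x Z) \<and>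
     (\<forall>p x f Y. smooth_fun_at A p f \<longrightarrow> smooth_vec_at A p Y \<longrightarrow>
        nab p x (\<lambda>q. f q *\<^sub>R Y q) = vderiv A p x f *\<^sub>R Y p + f p *\<^sub>R nab p x Y) \<and>
     (\<forall>p X Y. smooth_vec_at A p X \<longrightarrow> smooth_vec_at A p Y \<longrightarrow>
        smooth_vec_at A p (\<lambda>q. nab q (X q) Y))"

definition levi_civita ::
    "('m, 'e::euclidean_space) acb_structure \<Rightarrow> ('m, 'e) connection \<Rightarrow> bool" where
  "levi_civita M nab \<longleftrightarrow>
     affine_connection (atlas M) nab \<and>
     (\<forall>p X Y. smooth_vec_at (atlas M) p X \<longrightarrow> smooth_vec_at (atlas M) p Y \<longrightarrow>
        nab p (X p) Y - nab p (Y p) X = lie_bracket (atlas M) X Y p) \<and>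
     (\<forall>p x Y Z. smooth_vec_at (atlas M) p Y \<longrightarrow> smooth_vec_at (atlas M) p Z \<longrightarrow>
        vderiv (atlas M) p x (\<lambda>q. gtensor M q (Y q) (Z q)) =
          gtensor M p (nab p x Y) (Z p) + gtensor M p (Y p) (nab p x Z))"

definition hor :: "('m, 'e::real_vector) acb_structure \<Rightarrow> 'm \<Rightarrow> 'e \<Rightarrow> 'e" where
  "hor M p x = x - eta M p x *\<^sub>R xi M p"

definition ver :: "('m, 'e::real_vector) acb_structure \<Rightarrow> 'm \<Rightarrow> 'e \<Rightarrow> 'e" where
  "ver M p x = eta M p x *\<^sub>R xi M p"

definition svk_connection ::
    "('m, 'e::real_vector) acb_structure \<Rightarrow> ('m, 'e) connection \<Rightarrow> ('m, 'e) connection" where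
  "svk_connection M nab p x Y =
     hor M p (nab p x (\<lambda>q. hor M q (Y q))) + ver M p (nab p x (\<lambda>q. ver M q (Y q)))"

definition svk_potential ::
    "('m, 'e::real_vector) acb_structure \<Rightarrow> ('m, 'e) connection \<Rightarrow>
       'm \<Rightarrow> ('m \<Rightarrow> 'e) \<Rightarrow> ('m \<Rightarrow> 'e) \<Rightarrow> 'e" where
  "svk_potential M nab p X Y = svk_connection M nab p (X p) Y - nab p (X p) Y"

definition svk_torsion ::
    "('m, 'e::euclidean_space) acb_structure \<Rightarrow> ('m, 'e) connection \<Rightarrow>
       'm \<Rightarrow> ('m \<Rightarrow> 'e) \<Rightarrow> ('m \<Rightarrow> 'e) \<Rightarrow> 'e" where
  "svk_torsion M nab p X Y =
     svk_connection M nab p (X p) Y - svk_connection M nab p (Y p) X - lie_bracket (atlas M) X Y p"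

definition svk_potential_ver ::
    "('m, 'e::real_vector) acb_structure \<Rightarrow> ('m, 'e) connection \<Rightarrow>
       'm \<Rightarrow> ('m \<Rightarrow> 'e) \<Rightarrow> ('m \<Rightarrow> 'e) \<Rightarrow> 'e" where
  "svk_potential_ver M nab p X Y = ver M p (svk_potential M nab p X Y)"

definition svk_torsion_ver ::
    "('m, 'e::euclidean_space) acb_structure \<Rightarrow> ('m, 'e) connection \<Rightarrow>
       'm \<Rightarrow> ('m \<Rightarrow> 'e) \<Rightarrow> ('m \<Rightarrow> 'e) \<Rightarrow> 'e" where
  "svk_torsion_ver M nab p X Y = ver M p (svk_torsion M nab p X Y)"


section \<open>Tensors derived from the structure\<close>

definition nabla_eta ::
    "('m, 'e::euclidean_space) acb_structure \<Rightarrow> ('m, 'e) connection \<Rightarrow>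
       'm \<Rightarrow> ('m \<Rightarrow> 'e) \<Rightarrow> ('m \<Rightarrow> 'e) \<Rightarrow> real" where
  "nabla_eta M nab p X Y =
     vderiv (atlas M) p (X p) (\<lambda>q. eta M q (Y q)) - eta M p (nab p (X p) Y)"

definition d_eta ::
    "('m, 'e::euclidean_space) acb_structure \<Rightarrow> 'm \<Rightarrow> ('m \<Rightarrow> 'e) \<Rightarrow> ('m \<Rightarrow> 'e) \<Rightarrow> real" where
  "d_eta M p X Y =
     vderiv (atlas M) p (X p) (\<lambda>q. eta M q (Y q)) - vderiv (atlas M) p (Y p) (\<lambda>q. eta M q (X q))
     - eta M p (lie_bracket (atlas M) X Y p)"

definition lie_xi_metric ::
    "('m, 'e::euclidean_space) acb_structure \<Rightarrow> 'm \<Rightarrow> ('m \<Rightarrow> 'e) \<Rightarrow> ('m \<Rightarrow> 'e) \<Rightarrow> real" where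
  "lie_xi_metric M p X Y =
     vderiv (atlas M) p (xi M p) (\<lambda>q. gtensor M q (X q) (Y q))
     - gtensor M p (lie_bracket (atlas M) (xi M) X p) (Y p)
     - gtensor M p (X p) (lie_bracket (atlas M) (xi M) Y p)"

definition shape ::
    "('m, 'e::real_vector) acb_structure \<Rightarrow> ('m, 'e) connection \<Rightarrow> 'm \<Rightarrow> 'e \<Rightarrow> 'e" where
  "shape M nab p x = - nab p x (xi M)"

definition shape_form ::
    "('m, 'e::real_vector) acb_structure \<Rightarrow> ('m, 'e) connection \<Rightarrow> 'm \<Rightarrow> 'e \<Rightarrow> 'e \<Rightarrow> real" where
  "shape_form M nab p x y = gtensor M p (shape M nab p x) y"

definition nabla_phi ::
    "('m, 'e::real_vector) acb_structure \<Rightarrow> ('m, 'e) connection \<Rightarrow> 'm \<Rightarrow> 'e \<Rightarrow> ('m \<Rightarrow> 'e) \<Rightarrow> 'e" where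
  "nabla_phi M nab p x Y = nab p x (\<lambda>q. phi M q (Y q)) - phi M p (nab p x Y)"

text \<open>The tensor \<open>F\<close> on the tangent space at \<open>p\<close>. As \<open>nabla_phi\<close> is tensorial, the choice of the
  extension of \<open>y\<close> to a smooth vector field is immaterial.\<close>

definition F_tensor ::
    "('m, 'e::euclidean_space) acb_structure \<Rightarrow> ('m, 'e) connection \<Rightarrow>
       'm \<Rightarrow> 'e \<Rightarrow> 'e \<Rightarrow> 'e \<Rightarrow> real" where
  "F_tensor M nab p x y z = gtensor M p (nabla_phi M nab p x (coord_field (atlas M) p y)) z"

text \<open>Properties of a tensor field of type \<open>(0,2)\<close> or \<open>(1,2)\<close> given on vector fields.\<close>

definition sym_field ::
    "('m, 'e::euclidean_space) acb_structure \<Rightarrow> ('m \<Rightarrow> ('m \<Rightarrow> 'e) \<Rightarrow> ('m \<Rightarrow> 'e) \<Rightarrow> 'b) \<Rightarrow> bool" where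
  "sym_field M B \<longleftrightarrow>
     (\<forall>p X Y. smooth_vec_at (atlas M) p X \<longrightarrow> smooth_vec_at (atlas M) p Y \<longrightarrow> B p X Y = B p Y X)"

definition skew_field ::
    "('m, 'e::euclidean_space) acb_structure \<Rightarrow>
       ('m \<Rightarrow> ('m \<Rightarrow> 'e) \<Rightarrow> ('m \<Rightarrow> 'e) \<Rightarrow> 'b::ab_group_add) \<Rightarrow> bool" where
  "skew_field M B \<longleftrightarrow>
     (\<forall>p X Y. smooth_vec_at (atlas M) p X \<longrightarrow> smooth_vec_at (atlas M) p Y \<longrightarrow> B p X Y = - B p Y X)"

definition zero_field ::
    "('m, 'e::euclidean_space) acb_structure \<Rightarrow>
       ('m \<Rightarrow> ('m \<Rightarrow> 'e) \<Rightarrow> ('m \<Rightarrow> 'e) \<Rightarrow> 'b::zero) \<Rightarrow> bool" where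
  "zero_field M B \<longleftrightarrow>
     (\<forall>p X Y. smooth_vec_at (atlas M) p X \<longrightarrow> smooth_vec_at (atlas M) p Y \<longrightarrow> B p X Y = 0)"


section \<open>The basic classes\<close>

type_synonym 'e tensor3 = "'e \<Rightarrow> 'e \<Rightarrow> 'e \<Rightarrow> real"

text \<open>In this section \<open>f\<close>, \<open>v\<close>, \<open>h\<close>, \<open>g\<close> are the values of \<open>\<phi>\<close>, \<open>\<xi>\<close>, \<open>\<eta>\<close>, \<open>g\<close> at one point.\<close>

definition F_space ::
    "('e::euclidean_space \<Rightarrow> 'e) \<Rightarrow> 'e \<Rightarrow> ('e \<Rightarrow> real) \<Rightarrow> 'e tensor3 set" where
  "F_space f v h =
     {F. (\<forall>x y. linear (\<lambda>z. F x y z)) \<and> (\<forall>x z. linear (\<lambda>y. F x y z)) \<and>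
         (\<forall>y z. linear (\<lambda>x. F x y z)) \<and>
         (\<forall>x y z. F x y z = F x z y \<and>
                  F x y z = F x (f y) (f z) + h y * F x v z + h z * F x y v)}"

definition ker_basis :: "nat \<Rightarrow> ('e::euclidean_space \<Rightarrow> real) \<Rightarrow> (nat \<Rightarrow> 'e) \<Rightarrow> bool" where
  "ker_basis n h e \<longleftrightarrow>
     inj_on e {..<2*n} \<and> independent (e ` {..<2*n}) \<and> span (e ` {..<2*n}) = {x. h x = 0}"

definition gram_inverse ::
    "nat \<Rightarrow> ('e \<Rightarrow> 'e \<Rightarrow> real) \<Rightarrow> (nat \<Rightarrow> 'e) \<Rightarrow> (nat \<Rightarrow> nat \<Rightarrow> real) \<Rightarrow> bool" where
  "gram_inverse n g e G \<longleftrightarrow>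
     (\<forall>i<2*n. \<forall>k<2*n. (\<Sum>j<2*n. G i j * g (e j) (e k)) = (if i = k then 1 else 0))"

text \<open>The trace \<open>g\<^sup>i\<^sup>j B(e\<^sub>i, e\<^sub>j)\<close> over a basis of the kernel of \<open>\<eta>\<close>; it does not depend on the
  basis.\<close>

definition ker_trace ::
    "nat \<Rightarrow> ('e::euclidean_space \<Rightarrow> real) \<Rightarrow> ('e \<Rightarrow> 'e \<Rightarrow> real) \<Rightarrow> ('e \<Rightarrow> 'e \<Rightarrow> real) \<Rightarrow> real" where
  "ker_trace n h g B =
     (let e = (SOME e. ker_basis n h e); G = (SOME G. gram_inverse n g e G)
      in \<Sum>i<2*n. \<Sum>j<2*n. G i j * B (e i) (e j))"

definition theta ::
    "nat \<Rightarrow> ('e::euclidean_space \<Rightarrow> real) \<Rightarrow> ('e \<Rightarrow> 'e \<Rightarrow> real) \<Rightarrow> 'e tensor3 \<Rightarrow> 'e \<Rightarrow> real" where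
  "theta n h g F z = ker_trace n h g (\<lambda>x y. F x y z)"

definition theta_star ::
    "nat \<Rightarrow> ('e::euclidean_space \<Rightarrow> 'e) \<Rightarrow> ('e \<Rightarrow> real) \<Rightarrow> ('e \<Rightarrow> 'e \<Rightarrow> real) \<Rightarrow>
       'e tensor3 \<Rightarrow> 'e \<Rightarrow> real" where
  "theta_star n f h g F z = ker_trace n h g (\<lambda>x y. F x (f y) z)"

datatype class_index = C1 | C2 | C3 | C4 | C5 | C6 | C7 | C8 | C9 | C10

fun basic_condition ::
    "nat \<Rightarrow> ('e::euclidean_space \<Rightarrow> 'e) \<Rightarrow> 'e \<Rightarrow> ('e \<Rightarrow> real) \<Rightarrow> ('e \<Rightarrow> 'e \<Rightarrow> real) \<Rightarrow>
       class_index \<Rightarrow> 'e tensor3 \<Rightarrow> bool" where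
  "basic_condition n f v h g C1 F \<longleftrightarrow>
     (\<forall>x y z. F x y z = 1 / (2 * real n) *
        (g x (f y) * theta n h g F (f z) + g (f x) (f y) * theta n h g F (f (f z)) +
         g x (f z) * theta n h g F (f y) + g (f x) (f z) * theta n h g F (f (f y))))"
| "basic_condition n f v h g C2 F \<longleftrightarrow>
     (\<forall>y z. F v y z = 0) \<and> (\<forall>x z. F x v z = 0) \<and>
     (\<forall>x y z. F x y (f z) + F y z (f x) + F z x (f y) = 0) \<and>
     (\<forall>z. theta n h g F z = 0)"
| "basic_condition n f v h g C3 F \<longleftrightarrow>
     (\<forall>y z. F v y z = 0) \<and> (\<forall>x z. F x v z = 0) \<and>
     (\<forall>x y z. F x y z + F y z x + F z x y = 0)"
| "basic_condition n f v h g C4 F \<longleftrightarrow>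
     (\<forall>x y z. F x y z = - (1 / (2 * real n)) * theta n h g F v *
        (g (f x) (f y) * h z + g (f x) (f z) * h y))"
| "basic_condition n f v h g C5 F \<longleftrightarrow>
     (\<forall>x y z. F x y z = - (1 / (2 * real n)) * theta_star n f h g F v *
        (g x (f y) * h z + g x (f z) * h y))"
| "basic_condition n f v h g C6 F \<longleftrightarrow>
     (\<forall>x y z. F x y z = F x y v * h z + F x z v * h y) \<and>
     (\<forall>x y. F x y v = F y x v \<and> F x y v = - F (f x) (f y) v) \<and>
     (\<forall>z. theta n h g F z = 0) \<and> (\<forall>z. theta_star n f h g F z = 0)"
| "basic_condition n f v h g C7 F \<longleftrightarrow>
     (\<forall>x y z. F x y z = F x y v * h z + F x z v * h y) \<and>
     (\<forall>x y. F x y v = - F y x v \<and> F x y v = - F (f x) (f y) v)"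
| "basic_condition n f v h g C8 F \<longleftrightarrow>
     (\<forall>x y z. F x y z = F x y v * h z + F x z v * h y) \<and>
     (\<forall>x y. F x y v = F y x v \<and> F x y v = F (f x) (f y) v)"
| "basic_condition n f v h g C9 F \<longleftrightarrow>
     (\<forall>x y z. F x y z = F x y v * h z + F x z v * h y) \<and>
     (\<forall>x y. F x y v = - F y x v \<and> F x y v = F (f x) (f y) v)"
| "basic_condition n f v h g C10 F \<longleftrightarrow>
     (\<forall>x y z. F x y z = F v (f y) (f z) * h x)"

definition basic_class ::
    "nat \<Rightarrow> ('e::euclidean_space \<Rightarrow> 'e) \<Rightarrow> 'e \<Rightarrow> ('e \<Rightarrow> real) \<Rightarrow> ('e \<Rightarrow> 'e \<Rightarrow> real) \<Rightarrow>
       class_index \<Rightarrow> 'e tensor3 set" where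
  "basic_class n f v h g k = {F \<in> F_space f v h. basic_condition n f v h g k F}"

text \<open>At every point, \<open>F\<close> lies in the sum of the subspaces with index in \<open>K\<close>. (These
  subspaces are independent, so that the sum is direct.)\<close>

definition in_classes ::
    "nat \<Rightarrow> ('m, 'e::euclidean_space) acb_structure \<Rightarrow> ('m, 'e) connection \<Rightarrow> class_index set \<Rightarrow> bool" where
  "in_classes n M nab K \<longleftrightarrow>
     (\<forall>p. \<exists>G. (\<forall>k\<in>K. G k \<in> basic_class n (phi M p) (xi M p) (eta M p) (gtensor M p) k) \<and>
              (\<forall>x y z. F_tensor M nab p x y z = (\<Sum>k\<in>K. G k x y z)))"

definition U1 :: "class_index set" where
  "U1 = {C1, C2, C3, C10}"

definition all_equivalent :: "bool list \<Rightarrow> bool" where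
  "all_equivalent Ps \<longleftrightarrow> (\<forall>P\<in>set Ps. \<forall>Q\<in>set Ps. P \<longleftrightarrow> Q)"

end

theory Submission
  imports Defs
begin

text \<open>
  Everything is governed by the bilinear form \<open>\<beta>(x, y) = g(\<nabla>\<^sub>x\<xi>, y)\<close> on each tangent space
  (\<open>nab_xi\<close> below). Since \<open>\<eta>(y) = g(y, \<xi>)\<close> and \<open>\<nabla>\<close> is metric and torsion-free, \<open>\<nabla>\<eta>\<close> is \<open>\<beta>\<close>,
  \<open>d\<eta>\<close> is twice the skew part of \<open>\<beta>\<close>, the Lie derivative of \<open>g\<close> along \<open>\<xi>\<close> is twice the symmetric part,
  the shape form is \<open>-\<beta>\<close>, and the vertical parts of the potential and the torsion of the Schouten-van
  Kampen connection are \<open>\<beta> \<xi>\<close> and \<open>d\<eta> \<xi>\<close>. So the tensor conditions in the three parts say that \<open>\<beta>\<close>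
  is symmetric, that it is skew and that it vanishes.

  For the classes, \<open>\<phi>\<xi> = 0\<close> gives \<open>F(x, y, \<xi>) = -\<beta>(x, \<phi>y)\<close>, hence \<open>\<beta>(x, y) = F(x, \<phi>y, \<xi>)\<close>, and
  the rest is linear algebra in one tangent space. Put \<open>A(x, y) = F(x, y, \<xi>)\<close>. The tensor \<open>F\<close> is the sum
  of \<open>A(x, y) \<eta>(z) + A(x, z) \<eta>(y)\<close> and of a tensor with vanishing \<open>A\<close>.

  \<^item> The tensors with \<open>A = 0\<close> are the sum of the classes 1, 2, 3 and 10 (\<open>vertical_zero_in_sum\<close>):
    class 10 takes the part \<open>F(\<xi>, y, z) \<eta>(x)\<close>, and what remains lives on the kernel of \<open>\<eta>\<close>. There
    \<open>\<phi>\<close> is a complex structure, and the remainder is split by the symmetry of its complex components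
    into class 3 and a part from which class 1 takes the trace and class 2 the rest
    (\<open>horizontal_in_sum\<close>).
  \<^item> If \<open>\<beta>\<close> is symmetric, then \<open>A(\<phi>x, \<phi>y) = -A(y, x)\<close>, so that the symmetric part of \<open>A\<close> is
    \<open>\<phi>\<close>-anti-invariant and the skew part \<open>\<phi>\<close>-invariant. The skew part is in class 9, and
    splitting off two traces from the symmetric part gives classes 4, 5 and 6 (\<open>lift_symmetric\<close>).
  \<^item> If \<open>\<beta>\<close> is skew, then \<open>A(\<phi>x, \<phi>y) = A(y, x)\<close>; the symmetric part of \<open>A\<close> is in class 8, the
    skew part in class 7 (\<open>lift_skew\<close>).

  Conversely, the condition defining each class forces the corresponding symmetry of \<open>A\<close>, and sums
  inherit it.
\<close>

section \<open>Traces over the kernel of the contact form\<close>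

locale acb_space =
  fixes n :: nat and f :: "'e::euclidean_space \<Rightarrow> 'e" and v :: 'e and h :: "'e \<Rightarrow> real"
    and g :: "'e \<Rightarrow> 'e \<Rightarrow> real"
  assumes dim: "DIM('e) = 2 * n + 1" and n_pos: "n \<ge> 1"
    and lin_f: "linear f" and lin_h: "linear h"
    and lin_g: "linear (g x)" and g_sym: "g x y = g y x"
    and sig: "has_signature g (n + 1) n"
    and f_v [simp]: "f v = 0"
    and f_f: "f (f x) = - x + h x *\<^sub>R v"
    and h_f [simp]: "h (f x) = 0"
    and h_v [simp]: "h v = 1"
    and g_f_f: "g (f x) (f y) = - g x y + h x * h y"
begin

lemmas f_simps [simp] = linear_0[OF lin_f] linear_add[OF lin_f] linear_diff[OF lin_f]
  linear_neg[OF lin_f] linear_scale[OF lin_f]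

lemmas h_simps [simp] = linear_0[OF lin_h] linear_add[OF lin_h] linear_diff[OF lin_h]
  linear_neg[OF lin_h] linear_scale[OF lin_h]

lemma lin_g_left: "linear (\<lambda>x. g x y)"
  using lin_g[of y] by (simp add: g_sym[of _ y])

lemmas g_simps [simp] = linear_0[OF lin_g] linear_add[OF lin_g] linear_diff[OF lin_g]
  linear_neg[OF lin_g] linear_scale[OF lin_g]
  linear_0[OF lin_g_left] linear_add[OF lin_g_left] linear_diff[OF lin_g_left]
  linear_neg[OF lin_g_left] linear_scale[OF lin_g_left]

lemma g_v [simp]: "g x v = h x" "g v x = h x"
  using g_f_f[of x v] g_sym[of x v] by simp_all

lemma g_f_left: "g (f x) y = g x (f y)"
  using g_f_f[of x "f y"] by (simp add: f_f)

lemma nondegenerate: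
  assumes "\<And>y. g x y = 0"
  shows "x = 0"
proof -
  obtain P N where PN: "finite P" "finite N" "independent (P \<union> N)"
    "span (P \<union> N) = UNIV"
    "\<forall>x\<in>P. g x x = 1" "\<forall>x\<in>N. g x x = -1"
    "\<forall>x\<in>P \<union> N. \<forall>y\<in>P \<union> N. x \<noteq> y \<longrightarrow> g x y = 0"
    using sig unfolding has_signature_def by blast
  have "x \<in> span (P \<union> N)" using PN(4) by simp
  then obtain c where c: "x = (\<Sum>b\<in>P \<union> N. c b *\<^sub>R b)"
    using PN(1,2) span_finite[of "P \<union> N"] by auto
  have "c b = 0" if b: "b \<in> P \<union> N" for b
  proof -
    have "0 = (\<Sum>a\<in>P \<union> N. c a * g a b)"
      using assms[of b] unfolding c by (simp add: linear_sum[OF lin_g_left])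
    also have "\<dots> = (\<Sum>a\<in>P \<union> N. if a = b then c b * g b b else 0)"
      using b PN(7) by (intro sum.cong) auto
    also have "\<dots> = c b * g b b"
      using b PN(1,2) by simp
    finally show ?thesis using b PN(5,6) by auto
  qed
  then show ?thesis by (simp add: c)
qed

text \<open>Nondegeneracy turns every functional into \<open>g(d, -)\<close>; this provides dual bases.\<close>

lemma riesz:
  assumes "linear l"
  obtains d where "\<And>x. g d x = l x"
proof -
  define \<Gamma> where "\<Gamma> x = (\<Sum>b\<in>Basis. g x b *\<^sub>R b)" for x
  have \<Gamma>: "\<Gamma> x \<bullet> y = g x y" for x y
  proof -
    have "g x y = g x (\<Sum>b\<in>Basis. (y \<bullet> b) *\<^sub>R b)" by (simp add: euclidean_representation)
    then show ?thesis
      by (simp add: \<Gamma>_def linear_sum[OF lin_g] inner_sum_left inner_commute[of y] mult.commute)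
  qed
  have lin: "linear \<Gamma>"
    by (rule linearI) (simp_all add: \<Gamma>_def scaleR_add_left sum.distrib scaleR_right.sum)
  have "inj \<Gamma>"
    unfolding linear_injective_0[OF lin] using \<Gamma> nondegenerate by (metis inner_zero_left)
  then have "surj \<Gamma>" by (rule linear_inj_imp_surj[OF lin])
  then obtain d where d: "\<Gamma> d = (\<Sum>b\<in>Basis. l b *\<^sub>R b)" by (metis surjD)
  have "g d x = l x" for x
  proof -
    have "l x = l (\<Sum>b\<in>Basis. (x \<bullet> b) *\<^sub>R b)" by (simp add: euclidean_representation)
    also have "\<dots> = \<Gamma> d \<bullet> x"
      by (simp add: d linear_sum[OF assms] linear_scale[OF assms] inner_sum_left
          inner_commute[of x] mult.commute)
    finally show ?thesis by (simp add: \<Gamma>)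
  qed
  then show thesis by (rule that)
qed

lemma ker_basis_exists: "\<exists>e. ker_basis n h e"
proof -
  define w where "w = (\<Sum>b\<in>Basis. h b *\<^sub>R b)"
  have h_inner: "h x = w \<bullet> x" for x
  proof -
    have "h x = h (\<Sum>b\<in>Basis. (x \<bullet> b) *\<^sub>R b)" by (simp add: euclidean_representation)
    then show ?thesis
      by (simp add: w_def linear_sum[OF lin_h] inner_sum_left inner_commute[of x] mult.commute)
  qed
  have "w \<noteq> 0" using h_inner[of v] by auto
  then have "dim {x. h x = 0} = 2 * n"
    using dim_hyperplane[of w] dim by (simp add: h_inner)
  then obtain B where B: "B \<subseteq> {x. h x = 0}" "independent B" "{x. h x = 0} \<subseteq> span B" "card B = 2 * n"
    using basis_exists[of "{x. h x = 0}"] by metis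
  have fin: "finite B" using B(2) by (rule independent_imp_finite)
  obtain e where e: "bij_betw e {..<2 * n} B"
    using ex_bij_betw_nat_finite[OF fin] by (auto simp: B(4) lessThan_atLeast0)
  have "subspace {x. h x = 0}" by (simp add: subspace_def)
  then have "span B = {x. h x = 0}" using B(1,3) by (metis span_subspace)
  then have "ker_basis n h e"
    using e B(2) by (simp add: ker_basis_def bij_betw_def)
  then show ?thesis by blast
qed

text \<open>The \<open>i\<close>-th row of the inverse consists of the coordinates of the vector representing the
  \<open>i\<close>-th dual functional.\<close>

lemma gram_inverse_exists:
  assumes "ker_basis n h e"
  shows "\<exists>G. gram_inverse n g e G"
proof -
  have e: "inj_on e {..<2*n}" "independent (e ` {..<2*n})" "span (e ` {..<2*n}) = {x. h x = 0}"
    using assms by (auto simp: ker_basis_def)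
  have "v \<notin> span (e ` {..<2*n})" by (simp add: e(3))
  then have ind: "independent (insert v (e ` {..<2*n}))"
    using e(2) by (simp add: independent_insert)
  have he: "h (e k) = 0" if "k < 2 * n" for k
    using e(3) span_base[of "e k" "e ` {..<2*n}"] that by auto
  have ve: "e k \<noteq> v" if "k < 2 * n" for k using he[OF that] h_v by force
  have "\<exists>c. \<forall>k<2*n. (\<Sum>j<2*n. c j * g (e j) (e k)) = (if i = k then 1 else 0)"
    if i: "i < 2*n" for i
  proof -
    (* The functional also has to vanish at v, so that its representing vector lies in the kernel. *)
    obtain l :: "'e \<Rightarrow> real" where l: "linear l"
      "\<forall>x\<in>insert v (e ` {..<2*n}). l x = (if x = e i then 1 else 0)"
      using linear_independent_extend[OF ind, of "\<lambda>x. if x = e i then 1 else 0"] by blast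
    obtain d where d: "\<And>x. g d x = l x" using riesz[OF l(1)] by blast
    have "h d = 0" using d[of v] l(2) ve[OF i] by auto
    then have "d \<in> span (e ` {..<2*n})" by (simp add: e(3))
    then obtain u where "d = (\<Sum>b\<in>e ` {..<2*n}. u b *\<^sub>R b)"
      using span_finite[of "e ` {..<2*n}"] by auto
    then have u: "d = (\<Sum>j<2*n. u (e j) *\<^sub>R e j)"
      by (simp add: sum.reindex[OF e(1)])
    have "(\<Sum>j<2*n. u (e j) * g (e j) (e k)) = (if i = k then 1 else 0)"
      if k: "k < 2 * n" for k
    proof -
      have "(\<Sum>j<2*n. u (e j) * g (e j) (e k)) = g d (e k)"
        by (simp add: u linear_sum[OF lin_g_left])
      also have "\<dots> = (if i = k then 1 else 0)"
        using l(2) k i inj_onD[OF e(1), of i k] by (auto simp: d)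
      finally show ?thesis .
    qed
    then show ?thesis by (intro exI[of _ "\<lambda>j. u (e j)"]) auto
  qed
  then obtain G
    where "\<forall>i<2*n. \<forall>k<2*n. (\<Sum>j<2*n. G i j * g (e j) (e k)) = (if i = k then 1 else 0)"
    by metis
  then show ?thesis unfolding gram_inverse_def by blast
qed

abbreviation tr :: "('e \<Rightarrow> 'e \<Rightarrow> real) \<Rightarrow> real" where
  "tr \<equiv> ker_trace n h g"

text \<open>The basis and the inverse Gram matrix are the ones that \<open>ker_trace\<close> selects, so that traces can be
  computed with them directly.\<close>

definition frame :: "nat \<Rightarrow> 'e" where
  "frame = (SOME e. ker_basis n h e)"

definition gram_inv :: "nat \<Rightarrow> nat \<Rightarrow> real" where
  "gram_inv = (SOME G. gram_inverse n g frame G)"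

text \<open>The \<open>g\<close>-dual basis of \<open>frame\<close>.\<close>

definition coframe :: "nat \<Rightarrow> 'e" where
  "coframe i = (\<Sum>j<2*n. gram_inv i j *\<^sub>R frame j)"

lemma ker_basis_frame: "ker_basis n h frame"
  unfolding frame_def by (rule someI_ex[OF ker_basis_exists])

lemma gram_inverse_gram_inv: "gram_inverse n g frame gram_inv"
  unfolding gram_inv_def by (rule someI_ex[OF gram_inverse_exists[OF ker_basis_frame]])

lemma tr_def: "tr B = (\<Sum>i<2*n. \<Sum>j<2*n. gram_inv i j * B (frame i) (frame j))"
  unfolding ker_trace_def frame_def[symmetric] gram_inv_def[symmetric] Let_def ..

lemma h_frame: "i < 2 * n \<Longrightarrow> h (frame i) = 0"
  using ker_basis_frame span_base[of "frame i" "frame ` {..<2*n}"] by (auto simp: ker_basis_def)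

lemma coframe_frame:
  "i < 2*n \<Longrightarrow> k < 2*n \<Longrightarrow> g (coframe i) (frame k) = (if i = k then 1 else 0)"
  using gram_inverse_gram_inv by (simp add: gram_inverse_def coframe_def linear_sum[OF lin_g_left])

text \<open>The matrix \<open>gram_inv\<close> is given as a left inverse only. As the Gram matrix of the dual basis it is
  symmetric, and thus a two-sided inverse.\<close>

lemma coframe_coframe:
  assumes "i < 2*n" "j < 2*n"
  shows "g (coframe i) (coframe j) = gram_inv j i"
proof -
  have "g (coframe i) (coframe j) = (\<Sum>k<2*n. gram_inv j k * g (coframe i) (frame k))"
    by (simp add: coframe_def[of j] linear_sum[OF lin_g])
  also have "\<dots> = (\<Sum>k<2*n. if k = i then gram_inv j i else 0)"
    using assms by (intro sum.cong) (auto simp: coframe_frame)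
  finally show ?thesis using assms by simp
qed

lemma gram_inv_sym: "i < 2*n \<Longrightarrow> j < 2*n \<Longrightarrow> gram_inv i j = gram_inv j i"
  using coframe_coframe[of i j] coframe_coframe[of j i] g_sym by simp

lemma frame_expansion:
  assumes z: "h z = 0"
  shows "(\<Sum>i<2*n. g (coframe i) z *\<^sub>R frame i) = z"
proof -
  have e: "inj_on frame {..<2*n}" "span (frame ` {..<2*n}) = {x. h x = 0}"
    using ker_basis_frame by (auto simp: ker_basis_def)
  have "z \<in> span (frame ` {..<2*n})" using z by (simp add: e(2))
  then obtain u where "z = (\<Sum>b\<in>frame ` {..<2*n}. u b *\<^sub>R b)"
    using span_finite[of "frame ` {..<2*n}"] by auto
  then have u: "z = (\<Sum>j<2*n. u (frame j) *\<^sub>R frame j)"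
    by (simp add: sum.reindex[OF e(1)])
  have "g (coframe i) z = u (frame i)" if i: "i < 2*n" for i
  proof -
    have "g (coframe i) z = (\<Sum>j<2*n. u (frame j) * g (coframe i) (frame j))"
      by (simp add: u linear_sum[OF lin_g])
    also have "\<dots> = (\<Sum>j<2*n. if j = i then u (frame i) else 0)"
      using i by (intro sum.cong) (auto simp: coframe_frame)
    finally show ?thesis using i by simp
  qed
  then show ?thesis by (simp add: u[symmetric])
qed

lemma tr_coframe:
  assumes "\<And>y. linear (\<lambda>x. B x y)"
  shows "tr B = (\<Sum>i<2*n. B (coframe i) (frame i))"
proof -
  have "B (coframe j) (frame j) = (\<Sum>i<2*n. gram_inv i j * B (frame i) (frame j))"
    if j: "j < 2*n" for j
  proof -
    have "B (coframe j) (frame j) = (\<Sum>i<2*n. gram_inv j i * B (frame i) (frame j))"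
      by (simp add: coframe_def linear_sum[OF assms] linear_scale[OF assms])
    also have "\<dots> = (\<Sum>i<2*n. gram_inv i j * B (frame i) (frame j))"
      using j by (intro sum.cong) (simp_all add: gram_inv_sym[of j])
    finally show ?thesis .
  qed
  moreover have "tr B = (\<Sum>j<2*n. \<Sum>i<2*n. gram_inv i j * B (frame i) (frame j))"
    unfolding tr_def by (rule sum.swap)
  ultimately show ?thesis by simp
qed

lemma tr_cong: "(\<And>x y. h x = 0 \<Longrightarrow> h y = 0 \<Longrightarrow> B x y = C x y) \<Longrightarrow> tr B = tr C"
  unfolding tr_def by (intro sum.cong refl) (simp add: h_frame)

lemma tr_add: "tr (\<lambda>x y. B x y + C x y) = tr B + tr C"
  by (simp add: ker_trace_def Let_def distrib_left sum.distrib)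

lemma tr_scale: "tr (\<lambda>x y. c * B x y) = c * tr B"
  by (simp add: ker_trace_def Let_def sum_distrib_left mult.left_commute)

lemma tr_metric: "tr g = 2 * real n"
  by (simp add: tr_coframe[OF lin_g_left] coframe_frame)

text \<open>Contraction of the metric against a functional: index raising followed by lowering.\<close>

lemma tr_contract:
  assumes l: "linear l" and z: "h z = 0"
  shows "tr (\<lambda>x y. g x z * l y) = l z"
proof -
  have lin: "linear (\<lambda>x. g x z * c)" for c
    by (rule linearI) (simp_all add: algebra_simps)
  have "l z = l (\<Sum>i<2*n. g (coframe i) z *\<^sub>R frame i)" by (simp add: frame_expansion z)
  then show ?thesis by (simp add: tr_coframe lin linear_sum[OF l] linear_scale[OF l])
qed

text \<open>A real operator with \<open>f\<^sup>3 = -f\<close> is traceless because it is skew for some inner product, here for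
  the form \<open>q\<close> in the proof, which makes \<open>f\<close> an isometry on the kernel of \<open>h\<close> and \<open>v\<close> orthogonal
  to that kernel.\<close>

lemma euclidean_trace_f: "(\<Sum>b\<in>Basis. f b \<bullet> b) = 0"
proof -
  (* As f f f = - f, replacing x and y by f x and f y swaps the first two summands. *)
  define q where "q x y = f (f x) \<bullet> f (f y) + f x \<bullet> f y + h x * h y" for x y
  define K where "K x = (\<Sum>b\<in>Basis. q x b *\<^sub>R b)" for x
  have q_lin: "linear (q x)" for x
    by (rule linearI) (simp_all add: q_def algebra_simps inner_add_right)
  have q_sym: "q x y = q y x" for x y by (simp add: q_def inner_commute)
  have expand: "l x = (\<Sum>b\<in>Basis. (x \<bullet> b) * l b)" if l: "linear l" for l :: "'e \<Rightarrow> real" and x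
  proof -
    have "l x = l (\<Sum>b\<in>Basis. (x \<bullet> b) *\<^sub>R b)" by (simp add: euclidean_representation)
    then show ?thesis by (simp add: linear_sum[OF l] linear_scale[OF l])
  qed
  have K: "K x \<bullet> y = q x y" for x y
    by (simp add: K_def expand[OF q_lin, of x y] inner_sum_left inner_commute[of y] mult.commute)
  have K_lin: "linear K"
    by (rule linearI)
      (simp_all add: K_def q_sym linear_add[OF q_lin] linear_scale[OF q_lin] q_sym[of _ "_ + _"]
        q_sym[of "_ + _"] q_sym[of "_ *\<^sub>R _"] scaleR_add_left sum.distrib scaleR_right.sum)
  have "x = 0" if "K x = 0" for x
  proof -
    have "q x x = 0" using K[of x x] that by simp
    moreover have "f (f x) \<bullet> f (f x) \<ge> 0" "f x \<bullet> f x \<ge> 0" "h x * h x \<ge> 0" by simp_all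
    ultimately have "f (f x) \<bullet> f (f x) = 0 \<and> h x * h x = 0" unfolding q_def by linarith
    then have ff: "f (f x) = 0" and hx: "h x = 0" by auto
    show ?thesis using f_f[of x] unfolding ff hx by simp
  qed
  then have "inj K" using K_lin by (simp add: linear_injective_0)
  then obtain R where R: "linear R" "\<And>x. R (K x) = x" "\<And>x. K (R x) = x"
    using linear_injective_isomorphism[OF K_lin] by blast
  have R_sym: "R x \<bullet> y = x \<bullet> R y" for x y
    using K[of "R x" "R y"] K[of "R y" "R x"] q_sym[of "R x" "R y"]
    by (simp add: R(3) inner_commute)
  (* The trace of f is the pairing of the skew form q (f x) y with the symmetric operator R. *)
  have skew: "q (f x) y = - q x (f y)" for x y
    by (simp add: q_def f_f[of "f _"] )
  have swap: "(R b \<bullet> c) * q (f b) c = - ((R c \<bullet> b) * q (f c) b)" for b c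
    using skew[of b c] q_sym[of b "f c"] R_sym[of b c] inner_commute[of b "R c"] by simp
  have "(\<Sum>b\<in>Basis. f b \<bullet> b) = (\<Sum>b\<in>Basis. q (f b) (R b))"
    by (intro sum.cong refl) (simp add: K[symmetric] R_sym[symmetric] R(2))
  also have "\<dots> = (\<Sum>b\<in>Basis. \<Sum>c\<in>Basis. (R b \<bullet> c) * q (f b) c)"
    by (simp add: expand[OF q_lin, of _ "R b" for b])
  finally have s: "(\<Sum>b\<in>Basis. f b \<bullet> b) = (\<Sum>b\<in>Basis. \<Sum>c\<in>Basis. (R b \<bullet> c) * q (f b) c)" .
  also have "\<dots> = (\<Sum>c\<in>Basis. \<Sum>b\<in>Basis. (R b \<bullet> c) * q (f b) c)" by (rule sum.swap)
  also have "\<dots> = (\<Sum>c\<in>Basis. \<Sum>b\<in>Basis. - ((R c \<bullet> b) * q (f c) b))"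
    by (intro sum.cong refl) (rule swap)
  also have "\<dots> = - (\<Sum>b\<in>Basis. f b \<bullet> b)" by (simp add: s sum_negf)
  finally show ?thesis by simp
qed

text \<open>The \<open>g\<close>-trace of \<open>g(x, fy)\<close> is the trace of the operator \<open>f\<close>. Its vanishing separates
  the traces \<open>\<theta>\<close> and \<open>\<theta>\<^sup>*\<close>: the tensors of class 4 have \<open>\<theta>\<^sup>*(\<xi>) = 0\<close>, those of class 5 have
  \<open>\<theta>(\<xi>) = 0\<close>, and class 1 reproduces its own \<open>\<theta>\<close>.\<close>

lemma tr_f: "tr (\<lambda>x y. g x (f y)) = 0"
proof -
  let ?d = coframe and ?e = frame
  have ff: "f b = (\<Sum>i<2*n. g (?d i) (- f (f b)) *\<^sub>R f (?e i))" for b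
  proof -
    have "f b = f (- f (f b))" by (simp add: f_f)
    also have "\<dots> = f (\<Sum>i<2*n. g (?d i) (- f (f b)) *\<^sub>R ?e i)"
      by (simp only: frame_expansion h_f linear_neg[OF lin_h] minus_zero)
    also have "\<dots> = (\<Sum>i<2*n. g (?d i) (- f (f b)) *\<^sub>R f (?e i))"
      by (simp only: linear_sum[OF lin_f] linear_scale[OF lin_f])
    finally show ?thesis .
  qed
  have lin: "linear (\<lambda>x. g (?d i) (- f (f x)))" for i
    by (rule linearI) simp_all
  have "(\<Sum>b\<in>Basis. f b \<bullet> b) = (\<Sum>b\<in>Basis. \<Sum>i<2*n. g (?d i) (- f (f b)) * (f (?e i) \<bullet> b))"
    by (subst ff) (simp only: inner_sum_left inner_scaleR_left)
  also have "\<dots> = (\<Sum>i<2*n. \<Sum>b\<in>Basis. (f (?e i) \<bullet> b) * g (?d i) (- f (f b)))"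
    by (subst sum.swap) (simp add: mult.commute)
  also have "\<dots> = (\<Sum>i<2*n. g (?d i) (- f (f (\<Sum>b\<in>Basis. (f (?e i) \<bullet> b) *\<^sub>R b))))"
    unfolding linear_sum[OF lin] linear_scale[OF lin] by simp
  also have "\<dots> = (\<Sum>i<2*n. g (?d i) (f (?e i)))"
    unfolding euclidean_representation by (simp add: f_f)
  finally show ?thesis by (simp add: tr_coframe lin_g_left euclidean_trace_f)
qed

lemma tr_metric_f:
  "tr (\<lambda>x y. g (f x) (f y)) = - (2 * real n)"
  "tr (\<lambda>x y. g x (f (f y))) = - (2 * real n)"
  "tr (\<lambda>x y. g (f x) (f (f y))) = 0"
proof -
  have "tr (\<lambda>x y. g (f x) (f y)) = tr (\<lambda>x y. -1 * g x y)"
    "tr (\<lambda>x y. g x (f (f y))) = tr (\<lambda>x y. -1 * g x y)"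
    "tr (\<lambda>x y. g (f x) (f (f y))) = tr (\<lambda>x y. -1 * g x (f y))"
    by (rule tr_cong; simp add: g_f_left f_f[of "_::'e"])+
  then show "tr (\<lambda>x y. g (f x) (f y)) = - (2 * real n)"
    "tr (\<lambda>x y. g x (f (f y))) = - (2 * real n)" "tr (\<lambda>x y. g (f x) (f (f y))) = 0"
    by (simp_all only: tr_scale tr_metric tr_f)
qed

lemma tr_flip: "tr (\<lambda>x y. B y x) = tr B"
proof -
  have "tr (\<lambda>x y. B y x) = (\<Sum>i<2*n. \<Sum>j<2*n. gram_inv j i * B (frame j) (frame i))"
    unfolding tr_def by (intro sum.cong refl) (simp add: gram_inv_sym)
  also have "\<dots> = tr B" unfolding tr_def by (rule sum.swap)
  finally show ?thesis .
qed

lemma coframe_expansion: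
  assumes "h z = 0"
  shows "(\<Sum>j<2*n. g (frame j) z *\<^sub>R coframe j) = z"
proof -
  have "(\<Sum>j<2*n. g (frame j) z *\<^sub>R coframe j)
      = (\<Sum>j<2*n. \<Sum>k<2*n. (gram_inv j k * g (frame j) z) *\<^sub>R frame k)"
    by (simp add: coframe_def scaleR_right.sum mult.commute)
  also have "\<dots> = (\<Sum>k<2*n. \<Sum>j<2*n. (gram_inv k j * g (frame j) z) *\<^sub>R frame k)"
    by (subst sum.swap) (intro sum.cong refl, simp add: gram_inv_sym)
  also have "\<dots> = (\<Sum>k<2*n. g (coframe k) z *\<^sub>R frame k)"
    by (simp add: coframe_def linear_sum[OF lin_g_left] scaleR_left.sum)
  finally show ?thesis by (simp add: frame_expansion assms)
qed

text \<open>If \<open>L\<close> is the operator with \<open>B(x, y) = g(Lx, y)\<close>, then, \<open>f\<close> being self-adjoint, this is the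
  identity \<open>tr(Lf) = tr(fL)\<close>.\<close>

lemma tr_f_shift:
  assumes B: "bilinear B"
  shows "tr (\<lambda>x y. B (f x) y) = tr (\<lambda>x y. B x (f y))"
proof -
  have lin: "linear (B x)" "linear (\<lambda>x. B x y)" for x y
    using B by (simp_all add: bilinear_def)
  have lin_f': "linear (\<lambda>x. B (f x) y)" for y
    using linear_compose[OF lin_f lin(2)] by (simp add: o_def)
  have 1: "f (coframe i) = (\<Sum>j<2*n. g (frame j) (f (coframe i)) *\<^sub>R coframe j)" for i
    by (simp add: coframe_expansion)
  have 2: "f (frame j) = (\<Sum>i<2*n. g (coframe i) (f (frame j)) *\<^sub>R frame i)" for j
    by (simp add: frame_expansion)
  have "tr (\<lambda>x y. B (f x) y)
      = (\<Sum>i<2*n. \<Sum>j<2*n. g (frame j) (f (coframe i)) * B (coframe j) (frame i))"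
    unfolding tr_coframe[OF lin_f']
    by (subst 1) (simp add: linear_sum[OF lin(2)] linear_scale[OF lin(2)])
  also have "\<dots> = (\<Sum>j<2*n. \<Sum>i<2*n. g (coframe i) (f (frame j)) * B (coframe j) (frame i))"
    by (subst sum.swap) (simp only: g_sym[of "frame _"] g_f_left)
  also have "\<dots> = tr (\<lambda>x y. B x (f y))"
    unfolding tr_coframe[OF lin(2)]
    by (subst 2) (simp add: linear_sum[OF lin(1)] linear_scale[OF lin(1)])
  finally show ?thesis .
qed

section \<open>Sums of basic classes\<close>

abbreviation cls :: "class_index \<Rightarrow> 'e tensor3 set" where
  "cls \<equiv> basic_class n f v h g"

text \<open>Membership in the sum of the classes with index in \<open>K\<close>, at one point; the pointwise content of
  \<open>in_classes\<close>.\<close>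

definition in_sum :: "class_index set \<Rightarrow> 'e tensor3 \<Rightarrow> bool" where
  "in_sum K F \<longleftrightarrow> (\<exists>G. (\<forall>k\<in>K. G k \<in> cls k) \<and> (\<forall>x y z. F x y z = (\<Sum>k\<in>K. G k x y z)))"

lemma in_sum_singleton: "F \<in> cls k \<Longrightarrow> in_sum {k} F"
  unfolding in_sum_def by (rule exI[of _ "\<lambda>_. F"]) simp

lemma in_sum_union:
  assumes "in_sum K F" "in_sum L F'" "K \<inter> L = {}" "finite K" "finite L"
    and "\<And>x y z. H x y z = F x y z + F' x y z"
  shows "in_sum (K \<union> L) H"
proof -
  obtain G G' where G: "\<forall>k\<in>K. G k \<in> cls k" "\<forall>x y z. F x y z = (\<Sum>k\<in>K. G k x y z)"
    and G': "\<forall>k\<in>L. G' k \<in> cls k" "\<forall>x y z. F' x y z = (\<Sum>k\<in>L. G' k x y z)"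
    using assms(1,2) unfolding in_sum_def by blast
  define G'' where "G'' k = (if k \<in> K then G k else G' k)" for k
  have G''_L: "G'' k = G' k" if "k \<in> L" for k
    using that assms(3) by (auto simp: G''_def)
  have "\<forall>k\<in>K \<union> L. G'' k \<in> cls k"
    using G(1) G'(1) by (auto simp: G''_def)
  moreover have "H x y z = (\<Sum>k\<in>K \<union> L. G'' k x y z)" for x y z
    using assms(3-6) G(2) G'(2)
    by (simp add: sum.union_disjoint G''_L) (simp add: G''_def)
  ultimately show ?thesis unfolding in_sum_def by blast
qed

text \<open>By the symmetry in the last two arguments, linearity in the middle one comes for free.\<close>

lemma F_spaceI:
  assumes "\<And>x y z z'. F x y (z + z') = F x y z + F x y z'"
    and "\<And>c x y z. F x y (c *\<^sub>R z) = c * F x y z"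
    and "\<And>x x' y z. F (x + x') y z = F x y z + F x' y z"
    and "\<And>c x y z. F (c *\<^sub>R x) y z = c * F x y z"
    and sym: "\<And>x y z. F x y z = F x z y"
    and "\<And>x y z. F x y z = F x (f y) (f z) + h y * F x v z + h z * F x y v"
  shows "F \<in> F_space f v h"
proof -
  have 1: "linear (\<lambda>z. F x y z)" for x y by (rule linearI) (simp_all add: assms(1,2))
  have "linear (\<lambda>y. F x y z)" for x z using 1[of x z] by (simp add: sym[of x _ z])
  moreover have "linear (\<lambda>x. F x y z)" for y z by (rule linearI) (simp_all add: assms(3,4))
  ultimately show ?thesis unfolding F_space_def using 1 assms(5,6) by blast
qed

context
  fixes F :: "'e tensor3"
  assumes F: "F \<in> F_space f v h"
begin

lemma F_sym: "F x y z = F x z y"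
  using F unfolding F_space_def by blast

lemma F_lin: "linear (\<lambda>x. F x y z)" "linear (\<lambda>y. F x y z)" "linear (\<lambda>z. F x y z)"
  using F unfolding F_space_def by blast+

lemma F_id: "F x y z = F x (f y) (f z) + h y * F x v z + h z * F x y v"
  using F unfolding F_space_def by blast

lemmas F_simps = linear_0[OF F_lin(1)] linear_add[OF F_lin(1)] linear_diff[OF F_lin(1)]
  linear_neg[OF F_lin(1)] linear_scale[OF F_lin(1)]
  linear_0[OF F_lin(2)] linear_add[OF F_lin(2)] linear_diff[OF F_lin(2)]
  linear_neg[OF F_lin(2)] linear_scale[OF F_lin(2)]
  linear_0[OF F_lin(3)] linear_add[OF F_lin(3)] linear_diff[OF F_lin(3)]
  linear_neg[OF F_lin(3)] linear_scale[OF F_lin(3)]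

lemma F_v_v: "F x v v = 0"
  using F_id[of x v v] by (simp add: F_simps)

lemma theta_linear: "linear (theta n h g F)"
  by (rule linearI) (simp_all add: theta_def F_simps tr_add tr_scale)

end

lemma F_space_add:
  assumes "F \<in> F_space f v h" "H \<in> F_space f v h"
  shows "(\<lambda>x y z. F x y z + H x y z) \<in> F_space f v h"
proof (rule F_spaceI)
  show "F x y z + H x y z = F x z y + H x z y" for x y z
    by (simp add: F_sym[OF assms(1), of x y z] F_sym[OF assms(2), of x y z])
  show "F x y z + H x y z = F x (f y) (f z) + H x (f y) (f z) + h y * (F x v z + H x v z)
    + h z * (F x y v + H x y v)" for x y z
    by (subst F_id[OF assms(1)], subst F_id[OF assms(2)]) (simp add: algebra_simps)
qed (simp_all add: F_simps[OF assms(1)] F_simps[OF assms(2)] algebra_simps)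

lemma F_space_scale:
  assumes "F \<in> F_space f v h"
  shows "(\<lambda>x y z. c * F x y z) \<in> F_space f v h"
proof (rule F_spaceI)
  show "c * F x y z = c * F x z y" for x y z by (simp add: F_sym[OF assms, of x y z])
  show "c * F x y z = c * F x (f y) (f z) + h y * (c * F x v z) + h z * (c * F x y v)" for x y z
    by (subst F_id[OF assms]) (simp add: algebra_simps)
qed (simp_all add: F_simps[OF assms] algebra_simps)

lemma F_space_diff:
  assumes "F \<in> F_space f v h" "H \<in> F_space f v h"
  shows "(\<lambda>x y z. F x y z - H x y z) \<in> F_space f v h"
  using F_space_add[OF assms(1) F_space_scale[OF assms(2), of "-1"]] by simp

lemma class_vertical_zero:
  assumes "F \<in> cls k" "k \<in> U1"
  shows "F x y v = 0"
proof -
  have F: "F \<in> F_space f v h" and c: "basic_condition n f v h g k F"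
    using assms(1) by (simp_all add: basic_class_def)
  consider "k = C1" | "k = C2" | "k = C3" | "k = C10" using assms(2) by (auto simp: U1_def)
  then show ?thesis
  proof cases
    case 1
    then have "F x y v = 1 / (2 * real n) *
        (g x (f y) * theta n h g F (f v) + g (f x) (f y) * theta n h g F (f (f v)) +
         g x (f v) * theta n h g F (f y) + g (f x) (f v) * theta n h g F (f (f y)))"
      using c unfolding \<open>k = C1\<close> basic_condition.simps by blast
    then show ?thesis by (simp add: linear_0[OF theta_linear[OF F]])
  next
    case 2
    then show ?thesis
      using c F_sym[OF F, of x y v] unfolding 2 basic_condition.simps by metis
  next
    case 3
    then show ?thesis
      using c F_sym[OF F, of x y v] unfolding 3 basic_condition.simps by metis
  next
    case 4
    then have "F x y v = F v (f y) (f v) * h x" using c unfolding 4 basic_condition.simps by blast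
    then show ?thesis by (simp add: F_simps[OF F])
  qed
qed

text \<open>In classes 6 and 9 the symmetry of \<open>A(x, y) = F(x, y, v)\<close> and its behaviour under \<open>f\<close> combine to
  \<open>A(x, fy) = A(y, fx)\<close>. In classes 4 and 5, \<open>A(x, fy)\<close> is a multiple of \<open>g(x, fy)\<close> or
  of \<open>g(fx, fy)\<close>, and both are symmetric.\<close>

lemma class_vertical_symmetric:
  assumes "F \<in> cls k" "k \<in> {C4, C5, C6, C9}"
  shows "F x (f y) v = F y (f x) v"
proof -
  have F: "F \<in> F_space f v h" and c: "basic_condition n f v h g k F"
    using assms(1) by (simp_all add: basic_class_def)
  note lin = F_simps[OF F] F_v_v[OF F]
  consider "k = C4" | "k = C5" | "k = C6" | "k = C9" using assms(2) by auto
  then show ?thesis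
  proof cases
    case 1
    have *: "F x y v = - (1 / (2 * real n)) * theta n h g F v * g (f x) (f y)" for x y
      using c[unfolded 1 basic_condition.simps, rule_format, of x y v] by simp
    show ?thesis unfolding * by (simp add: g_f_left f_f[of "f _"] g_sym[of y "f x"])
  next
    case 2
    have *: "F x y v = - (1 / (2 * real n)) * theta_star n f h g F v * g x (f y)" for x y
      using c[unfolded 2 basic_condition.simps, rule_format, of x y v] by simp
    show ?thesis unfolding * by (simp add: f_f g_sym[of x y])
  next
    case 3
    have s: "F x y v = F y x v" and t: "F x y v = - F (f x) (f y) v" for x y
      using c unfolding 3 basic_condition.simps by blast+
    show ?thesis
      using t[of x "f y"] s[of y "f x"] by (simp add: f_f lin)
  next
    case 4
    have s: "F x y v = - F y x v" and t: "F x y v = F (f x) (f y) v" for x y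
      using c unfolding 4 basic_condition.simps by blast+
    show ?thesis
      using t[of x "f y"] s[of y "f x"] by (simp add: f_f lin)
  qed
qed

text \<open>Compared with classes 9 and 6, exactly one of the two signs is changed.\<close>

lemma class_vertical_skew:
  assumes "F \<in> cls k" "k \<in> {C7, C8}"
  shows "F x (f y) v = - F y (f x) v"
proof -
  have F: "F \<in> F_space f v h" and c: "basic_condition n f v h g k F"
    using assms(1) by (simp_all add: basic_class_def)
  note lin = F_simps[OF F] F_v_v[OF F]
  consider "k = C7" | "k = C8" using assms(2) by auto
  then show ?thesis
  proof cases
    case 1
    have s: "F x y v = - F y x v" and t: "F x y v = - F (f x) (f y) v" for x y
      using c unfolding 1 basic_condition.simps by blast+
    show ?thesis
      using t[of x "f y"] s[of y "f x"] by (simp add: f_f lin)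
  next
    case 2
    have s: "F x y v = F y x v" and t: "F x y v = F (f x) (f y) v" for x y
      using c unfolding 2 basic_condition.simps by blast+
    show ?thesis
      using t[of x "f y"] s[of y "f x"] by (simp add: f_f lin)
  qed
qed

text \<open>The tensor determined by \<open>F(x, y, v) = A(x, y)\<close> alone; all tensors of the classes 4 to 9 have
  this form.\<close>

definition lift :: "('e \<Rightarrow> 'e \<Rightarrow> real) \<Rightarrow> 'e tensor3" where
  "lift A x y z = A x y * h z + A x z * h y"

lemma lift_F_space:
  assumes "bilinear A" "\<And>x. A x v = 0"
  shows "lift A \<in> F_space f v h"
  by (rule F_spaceI)
    (simp_all add: lift_def assms(2) bilinear_ladd[OF assms(1)] bilinear_radd[OF assms(1)]
      bilinear_lmul[OF assms(1)] bilinear_rmul[OF assms(1)] algebra_simps)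

lemma lift_scale_class_4:
  "lift (\<lambda>x y. c * g (f x) (f y)) \<in> cls C4"
proof -
  let ?F = "lift (\<lambda>x y. c * g (f x) (f y))"
  have "bilinear (\<lambda>x y. c * g (f x) (f y))"
    unfolding bilinear_def by (auto intro!: linearI simp: algebra_simps)
  then have F: "?F \<in> F_space f v h" by (rule lift_F_space) simp
  have "theta n h g ?F v = tr (\<lambda>x y. (- c) * g x y)"
    unfolding theta_def by (rule tr_cong) (simp add: lift_def g_f_f)
  then have "theta n h g ?F v = - c * (2 * real n)"
    by (simp only: tr_scale tr_metric)
  then have c: "- (1 / (2 * real n)) * theta n h g ?F v = c" using n_pos by simp
  have "basic_condition n f v h g C4 ?F"
    unfolding basic_condition.simps c by (simp add: lift_def algebra_simps)
  then show ?thesis using F by (simp add: basic_class_def)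
qed

lemma lift_scale_class_5:
  "lift (\<lambda>x y. c * g x (f y)) \<in> cls C5"
proof -
  let ?F = "lift (\<lambda>x y. c * g x (f y))"
  have "bilinear (\<lambda>x y. c * g x (f y))"
    unfolding bilinear_def by (auto intro!: linearI simp: algebra_simps)
  then have F: "?F \<in> F_space f v h" by (rule lift_F_space) simp
  have "theta_star n f h g ?F v = tr (\<lambda>x y. (- c) * g x y)"
    unfolding theta_star_def by (rule tr_cong) (simp add: lift_def f_f)
  then have "theta_star n f h g ?F v = - c * (2 * real n)"
    by (simp only: tr_scale tr_metric)
  then have c: "- (1 / (2 * real n)) * theta_star n f h g ?F v = c" using n_pos by simp
  have "basic_condition n f v h g C5 ?F"
    unfolding basic_condition.simps c by (simp add: lift_def algebra_simps)
  then show ?thesis using F by (simp add: basic_class_def)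
qed

lemma lift_class_6:
  assumes A: "bilinear A" "\<And>x. A x v = 0" "\<And>x y. A x y = A y x" "\<And>x y. A (f x) (f y) = - A x y"
    and tr: "tr A = 0" "tr (\<lambda>x y. A x (f y)) = 0"
  shows "lift A \<in> cls C6"
proof -
  have "theta n h g (lift A) z = tr (\<lambda>x y. h z * A x y)" for z
    unfolding theta_def by (rule tr_cong) (simp add: lift_def)
  moreover have "theta_star n f h g (lift A) z = tr (\<lambda>x y. h z * A x (f y))" for z
    unfolding theta_star_def by (rule tr_cong) (simp add: lift_def)
  ultimately show ?thesis
    using A(3) unfolding basic_class_def
    by (simp add: lift_F_space[OF A(1,2)] tr_scale tr lift_def A(2,4))
qed

lemma lift_class_7:
  assumes A: "bilinear A" "\<And>x. A x v = 0" "\<And>x y. A x y = - A y x" "\<And>x y. A (f x) (f y) = - A x y"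
  shows "lift A \<in> cls C7"
  unfolding basic_class_def using lift_F_space[OF A(1,2)]
  by (auto simp: lift_def A(2,4) intro: A(3))

lemma lift_class_8:
  assumes A: "bilinear A" "\<And>x. A x v = 0" "\<And>x y. A x y = A y x" "\<And>x y. A (f x) (f y) = A x y"
  shows "lift A \<in> cls C8"
  unfolding basic_class_def using lift_F_space[OF A(1,2)]
  by (auto simp: lift_def A(2,4) intro: A(3))

lemma lift_class_9:
  assumes A: "bilinear A" "\<And>x. A x v = 0" "\<And>x y. A x y = - A y x" "\<And>x y. A (f x) (f y) = A x y"
  shows "lift A \<in> cls C9"
  unfolding basic_class_def using lift_F_space[OF A(1,2)]
  by (auto simp: lift_def A(2,4) intro: A(3))

text \<open>The assumption forces \<open>A(v, y) = 0\<close> and \<open>A(fx, fy) = -A(y, x)\<close>. So the symmetric part of \<open>A\<close> has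
  the symmetries of classes 4, 5 and 6, and the skew part those of class 9. Classes 4 and 5 are
  the multiples of \<open>g(fx, fy)\<close> and \<open>g(x, fy)\<close>; subtracting suitable multiples from the symmetric
  part makes both of its traces vanish, as class 6 demands.\<close>

lemma lift_symmetric:
  assumes A: "bilinear A" "\<And>x. A x v = 0" and B: "\<And>x y. A x (f y) = A y (f x)"
  shows "in_sum {C4, C5, C6, C9} (lift A)"
proof -
  note lin = bilinear_ladd[OF A(1)] bilinear_radd[OF A(1)] bilinear_lmul[OF A(1)]
    bilinear_rmul[OF A(1)] bilinear_lneg[OF A(1)] bilinear_rneg[OF A(1)]
    bilinear_lsub[OF A(1)] bilinear_rsub[OF A(1)]
  have v: "A v y = 0" for y
    using B[of v "f y"] by (simp add: f_f A(2) lin bilinear_rzero[OF A(1)])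
  have ff: "A (f x) (f y) = - A y x" for x y
    using B[of "f x" y] by (simp add: f_f A(2) lin)
  (* With these factors the traces of the class 4 and class 5 summands are those of A. *)
  define a where "a = - tr A / (2 * real n)"
  define b where "b = - tr (\<lambda>x y. A x (f y)) / (2 * real n)"
  define S where "S x y = (A x y + A y x) / 2 + (- a) * g (f x) (f y) + (- b) * g x (f y)" for x y
  define K where "K x y = (A x y - A y x) / 2" for x y
  have bil: "bilinear S" "bilinear K"
    unfolding bilinear_def S_def K_def
    by (auto intro!: linearI simp: lin algebra_simps add_divide_distrib diff_divide_distrib)
  (* Because of this equality only the trace of A x (f y) enters the factor b. *)
  have tr_A: "tr (\<lambda>x y. A (f y) x) = tr (\<lambda>x y. A x (f y))"
    using tr_flip[of "\<lambda>x y. A (f x) y"] tr_f_shift[OF A(1)] by simp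
  have S: "lift S \<in> cls C6"
  proof (rule lift_class_6[OF bil(1)])
    show "S x v = 0" for x by (simp add: S_def A(2) v)
    show "S x y = S y x" for x y
      using g_sym[of "f x" "f y"] g_sym[of x "f y"] g_f_left[of y x] by (simp add: S_def)
    show "S (f x) (f y) = - S x y" for x y
      using g_f_f[of "f x" "f y"] g_f_f[of x "f y"] by (simp add: S_def ff field_simps)
    have "tr S = tr (\<lambda>x y. 1/2 * (A x y + A y x) + (- a) * g (f x) (f y) + (- b) * g x (f y))"
      by (simp add: S_def[abs_def])
    then show "tr S = 0"
      unfolding tr_add tr_scale tr_flip[of A] tr_metric_f tr_f using n_pos by (simp add: a_def)
    have "tr (\<lambda>x y. S x (f y)) = tr (\<lambda>x y. 1/2 * (A x (f y) + A (f y) x)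
        + (- a) * g (f x) (f (f y)) + (- b) * g x (f (f y)))"
      by (simp add: S_def[abs_def])
    then show "tr (\<lambda>x y. S x (f y)) = 0"
      unfolding tr_add tr_scale tr_A tr_metric_f tr_f using n_pos by (simp add: b_def)
  qed
  have K: "lift K \<in> cls C9"
    by (rule lift_class_9[OF bil(2)]) (simp_all add: K_def A(2) v ff field_simps)
  have "in_sum ({C4} \<union> ({C5} \<union> ({C6} \<union> {C9}))) (lift A)"
    by (rule in_sum_union[OF in_sum_singleton[OF lift_scale_class_4[of a]]
        in_sum_union[OF in_sum_singleton[OF lift_scale_class_5[of b]]
          in_sum_union[OF in_sum_singleton[OF S] in_sum_singleton[OF K] _ _ _ refl] _ _ _ refl]])
      (auto simp: lift_def S_def K_def field_simps)
  then show ?thesis by (simp only: insert_is_Un[symmetric])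
qed

text \<open>Here \<open>A(v, y) = 0\<close> and \<open>A(fx, fy) = A(y, x)\<close>, so that the symmetric part of \<open>A\<close> is invariant
  and the skew part anti-invariant.\<close>

lemma lift_skew:
  assumes A: "bilinear A" "\<And>x. A x v = 0" and B: "\<And>x y. A x (f y) = - A y (f x)"
  shows "in_sum {C7, C8} (lift A)"
proof -
  note lin = bilinear_ladd[OF A(1)] bilinear_radd[OF A(1)] bilinear_lmul[OF A(1)]
    bilinear_rmul[OF A(1)] bilinear_lneg[OF A(1)] bilinear_rneg[OF A(1)]
    bilinear_lsub[OF A(1)] bilinear_rsub[OF A(1)]
  have v: "A v y = 0" for y
    using B[of v "f y"] by (simp add: f_f A(2) lin bilinear_rzero[OF A(1)])
  have ff: "A (f x) (f y) = A y x" for x y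
    using B[of "f x" y] by (simp add: f_f A(2) lin)
  define S where "S x y = (A x y + A y x) / 2" for x y
  define K where "K x y = (A x y - A y x) / 2" for x y
  have bil: "bilinear S" "bilinear K"
    unfolding bilinear_def S_def K_def
    by (auto intro!: linearI simp: lin algebra_simps add_divide_distrib diff_divide_distrib)
  have S: "lift S \<in> cls C8"
    by (rule lift_class_8[OF bil(1)]) (simp_all add: S_def A(2) v ff field_simps)
  have K: "lift K \<in> cls C7"
    by (rule lift_class_7[OF bil(2)]) (simp_all add: K_def A(2) v ff field_simps)
  have "in_sum ({C7} \<union> {C8}) (lift A)"
    by (rule in_sum_union[OF in_sum_singleton[OF K] in_sum_singleton[OF S]])
      (auto simp: lift_def S_def K_def field_simps)
  then show ?thesis by (simp only: insert_is_Un[symmetric])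
qed

text \<open>The tensors that are determined by their restriction to the kernel of \<open>h\<close>.\<close>

definition horizontal :: "'e tensor3 \<Rightarrow> bool" where
  "horizontal F \<longleftrightarrow> F \<in> F_space f v h \<and> (\<forall>y z. F v y z = 0) \<and> (\<forall>x y. F x y v = 0)"

context
  fixes F :: "'e tensor3"
  assumes hor: "horizontal F"
begin

lemma hor_F_space: "F \<in> F_space f v h"
  using hor by (simp add: horizontal_def)

lemma hor_v: "F v y z = 0" "F x v z = 0" "F x y v = 0"
  using hor F_sym[OF hor_F_space, of x v z] by (simp_all add: horizontal_def)

lemmas hor_lin = F_simps[OF hor_F_space] hor_v

text \<open>Apply the identity defining \<open>F_space\<close> to \<open>fy\<close>. In this form it says that \<open>F(x, -, -)\<close> pairs vectors
  of opposite type with respect to the complex structure \<open>f\<close> on the complexified kernel of \<open>h\<close>.\<close>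

lemma hor_f_mid: "F x (f y) z = - F x y (f z)"
  using F_id[OF hor_F_space, of x "f y" z] by (simp add: f_f hor_lin)

lemma hor_f_f: "F (f (f x)) y z = - F x y z" "F x y (f (f z)) = - F x y z"
  by (simp_all add: f_f hor_lin)

lemma hor_f_swap: "F x y (f z) = - F x z (f y)"
  using F_sym[OF hor_F_space, of x y "f z"] by (simp add: hor_f_mid)

text \<open>Over the complex numbers a horizontal \<open>F\<close> is determined by the components \<open>F(a, b, c)\<close> with \<open>a\<close>, \<open>b\<close> of
  one type (eigenvectors of \<open>f\<close> for the same eigenvalue) and \<open>c\<close> of the other. Class 3 consists of
  the tensors whose components are skew in \<open>a\<close> and \<open>b\<close>; in classes 1 and 2 they are symmetric. The
  tensor \<open>sym_part\<close> symmetrizes them: \<open>(F(y, x, z) - F(fy, fx, z)) / 2\<close> equals \<open>F(y, x, z)\<close> if \<open>x\<close> and \<open>y\<close> have the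
  same type, and vanishes otherwise; the last two terms do the same for \<open>x\<close> and \<open>z\<close>.\<close>

definition sym_part :: "'e tensor3" where
  "sym_part x y z = F x y z / 2
     + (F y x z - F (f y) (f x) z + F z x y - F (f z) (f x) y) / 4"

lemma sym_part_horizontal: "horizontal sym_part"
  unfolding horizontal_def
proof (intro conjI allI)
  show "sym_part \<in> F_space f v h"
  proof (rule F_spaceI)
    show "sym_part x y z = sym_part x z y" for x y z
      using F_sym[OF hor_F_space, of x y z] by (simp add: sym_part_def)
    show "sym_part x y z = sym_part x (f y) (f z) + h y * sym_part x v z
        + h z * sym_part x y v" for x y z
      by (simp add: sym_part_def hor_lin hor_f_mid hor_f_f)
  qed (simp_all add: sym_part_def hor_lin field_simps)
qed (simp_all add: sym_part_def hor_lin)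

lemma sym_part_cyclic: "sym_part x y (f z) + sym_part y z (f x) + sym_part z x (f y) = 0"
  using F_sym[OF hor_F_space, of "f x" y z] F_sym[OF hor_F_space, of "f y" x z]
    F_sym[OF hor_F_space, of "f z" x y]
    hor_f_swap[of x y z] hor_f_swap[of y z x] hor_f_swap[of z x y]
  by (simp add: sym_part_def hor_f_mid hor_f_f field_simps)

lemma skew_part_class_3: "(\<lambda>x y z. F x y z - sym_part x y z) \<in> cls C3"
proof -
  have sp: "sym_part \<in> F_space f v h"
    using sym_part_horizontal by (simp add: horizontal_def)
  have "(F x y z - sym_part x y z) + (F y z x - sym_part y z x) + (F z x y - sym_part z x y) = 0"
    for x y z
    using F_sym[OF hor_F_space, of x y z] F_sym[OF hor_F_space, of y x z]
      F_sym[OF hor_F_space, of z x y]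
      hor_f_swap[of "f x" y z] hor_f_swap[of "f y" z x] hor_f_swap[of "f z" x y]
    by (simp add: sym_part_def hor_f_mid hor_f_f field_simps)
  then show ?thesis
    unfolding basic_class_def using F_space_diff[OF hor_F_space sp]
    by (simp add: sym_part_def hor_lin)
qed

end

text \<open>The general tensor of class 1, with a functional \<open>t\<close> in the place of \<open>\<theta>\<close>.\<close>

definition trace_part :: "('e \<Rightarrow> real) \<Rightarrow> 'e tensor3" where
  "trace_part t x y z = 1 / (2 * real n) *
     (g x (f y) * t (f z) + g (f x) (f y) * t (f (f z)) +
      g x (f z) * t (f y) + g (f x) (f z) * t (f (f y)))"

lemma trace_part_F_space:
  assumes t: "linear t"
  shows "trace_part t \<in> F_space f v h"
proof (rule F_spaceI)
  note t' = linear_0[OF t] linear_add[OF t] linear_scale[OF t] linear_neg[OF t]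
  show "trace_part t x y z = trace_part t x (f y) (f z) + h y * trace_part t x v z
      + h z * trace_part t x y v"
    for x y z
    using g_f_f[of x y] g_f_f[of x z] g_f_f[of x "f y"] g_f_f[of x "f z"]
    by (simp add: trace_part_def t' f_f[of y] f_f[of z] f_f[of "f _"] mult.commute)
qed (simp_all add: trace_part_def linear_add[OF t] linear_scale[OF t] algebra_simps)

text \<open>Up to the factor \<open>1 / 2n\<close>, the first summand of \<open>trace_part\<close> contributes a multiple of the trace
  of \<open>f\<close>, which is 0, the second contributes \<open>2n t(z)\<close>, and the last two cancel.\<close>

lemma theta_trace_part:
  assumes t: "linear t" and v: "t v = 0"
  shows "theta n h g (trace_part t) z = t z"
proof -
  have g_f_f_right: "g x (f (f y)) = - g x y + h x * h y" for x y
    by (simp add: f_f)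
  have t_f_f: "t (f (f z)) = - t z" for z
    by (simp add: f_f linear_add[OF t] linear_scale[OF t] linear_neg[OF t] linear_diff[OF t] v)
  have lin: "linear (\<lambda>y. t (f y))"
    using linear_compose[OF lin_f t] by (simp add: o_def)
  have "theta n h g (trace_part t) z = tr (\<lambda>x y. 1 / (2 * real n) *
     (t (f z) * g x (f y) + - t z * g (f x) (f y) +
      g x (f z) * t (f y) + g x (- f (f z)) * t y))"
    unfolding theta_def by (rule tr_cong) (simp add: trace_part_def t_f_f g_f_f g_f_f_right)
  also have "\<dots> = 1 / (2 * real n) *
     (t (f z) * 0 + - t z * - (2 * real n) + t (f (f z)) + t (- f (f z)))"
    unfolding tr_scale tr_add tr_f tr_metric_f
    by (simp only: tr_contract[OF lin] tr_contract[OF t] h_f linear_neg[OF lin_h] minus_zero)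
  finally show ?thesis using n_pos by (simp add: t_f_f linear_neg[OF t])
qed

text \<open>The skew components of \<open>F\<close> form the summand of class 3. The symmetric ones satisfy the cyclic
  identity of class 2; subtracting the tensor of class 1 with the same \<open>\<theta>\<close> retains this identity
  and makes \<open>\<theta>\<close> vanish.\<close>

lemma horizontal_in_sum:
  assumes "horizontal F"
  shows "in_sum {C1, C2, C3} F"
proof -
  define P where "P = sym_part F"
  have P: "horizontal P" unfolding P_def by (rule sym_part_horizontal[OF assms])
  note PF = hor_F_space[OF P]
  define t where "t = theta n h g P"
  have t: "linear t" unfolding t_def by (rule theta_linear[OF PF])
  have tv: "t v = 0" by (simp add: t_def theta_def hor_v[OF P] ker_trace_def)
  let ?T = "trace_part t"
  have 1: "?T \<in> cls C1"
    unfolding basic_class_def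
    by (simp add: trace_part_F_space[OF t] theta_trace_part[OF t tv]) (simp add: trace_part_def)
  have tf: "t (f (f z)) = - t z" for z
    by (simp add: f_f linear_diff[OF t] linear_scale[OF t] linear_add[OF t] linear_neg[OF t] tv)
  have g_f_f_right: "g x (f (f y)) = g (f x) (f y)" for x y
    by (simp add: g_f_left)
  have T_f: "?T x y (f z) = 1 / (2 * real n) *
      (g (f x) (f z) * t (f y) - g (f x) (f y) * t (f z) + g x (f z) * t y - g x (f y) * t z)" for x y z
    using g_f_f[of x "f z"] by (simp add: trace_part_def tf g_f_f_right)
  have g_f_sym: "g (f x) (f y) = g (f y) (f x)" "g x (f y) = g y (f x)" for x y
    using g_sym g_f_left by metis+
  have T_cyc: "?T x y (f z) + ?T y z (f x) + ?T z x (f y) = 0" for x y z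
    unfolding T_f distrib_left[symmetric]
    using g_f_sym[of x y] g_f_sym[of x z] g_f_sym[of y z] by simp
  have "theta n h g (\<lambda>x y z. P x y z - ?T x y z) z = 0" for z
  proof -
    have "theta n h g (\<lambda>x y z. P x y z - ?T x y z) z = tr (\<lambda>x y. P x y z + -1 * ?T x y z)"
      by (simp add: theta_def)
    also have "\<dots> = theta n h g P z - theta n h g ?T z"
      unfolding tr_add tr_scale by (simp add: theta_def)
    finally show ?thesis by (simp add: theta_trace_part[OF t tv] t_def[symmetric])
  qed
  moreover have "?T v y z = 0" "?T y v z = 0" for y z
    by (simp_all add: trace_part_def linear_0[OF t])
  moreover have "(P x y (f z) - ?T x y (f z)) + (P y z (f x) - ?T y z (f x))
      + (P z x (f y) - ?T z x (f y)) = 0"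
    for x y z
    using T_cyc[of x y z] sym_part_cyclic[OF assms, of x y z] unfolding P_def by linarith
  ultimately have 2: "(\<lambda>x y z. P x y z - ?T x y z) \<in> cls C2"
    unfolding basic_class_def using F_space_diff[OF PF trace_part_F_space[OF t]]
    by (simp add: hor_v[OF P])
  have 3: "(\<lambda>x y z. F x y z - P x y z) \<in> cls C3"
    unfolding P_def by (rule skew_part_class_3[OF assms])
  have "in_sum ({C1} \<union> ({C2} \<union> {C3})) F"
    by (rule in_sum_union[OF in_sum_singleton[OF 1]
          in_sum_union[OF in_sum_singleton[OF 2] in_sum_singleton[OF 3] _ _ _ refl]])
      auto
  then show ?thesis by (simp only: insert_is_Un[symmetric])
qed

text \<open>The part of \<open>F\<close> along \<open>h(x)\<close> is in class 10, and its removal leaves a horizontal tensor.\<close>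

lemma vertical_zero_in_sum:
  assumes F: "F \<in> F_space f v h" and v: "\<And>x y. F x y v = 0"
  shows "in_sum U1 F"
proof -
  have v': "F x v z = 0" for x z using F_sym[OF F, of x v z] v by simp
  have id: "F x (f y) (f z) = F x y z" for x y z
    using F_id[OF F, of x y z] by (simp add: v v')
  define T where "T x y z = h x * F v y z" for x y z
  have T: "T \<in> F_space f v h"
  proof (rule F_spaceI)
    show "T x y z = T x z y" for x y z by (simp add: T_def F_sym[OF F, of v y z])
  qed (simp_all add: T_def F_simps[OF F] id v v' algebra_simps)
  then have 10: "T \<in> cls C10"
    unfolding basic_class_def by (simp add: T_def id)
  have "horizontal (\<lambda>x y z. F x y z - T x y z)"
    unfolding horizontal_def using F_space_diff[OF F T] by (simp add: T_def v)
  then have "in_sum ({C1, C2, C3} \<union> {C10}) F"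
    by (rule in_sum_union[OF horizontal_in_sum in_sum_singleton[OF 10]]) auto
  then show ?thesis by (simp only: U1_def Un_insert_left Un_empty_left)
qed

lemma in_sum_split:
  assumes F: "F \<in> F_space f v h" and L: "in_sum L (lift (\<lambda>x y. F x y v))" "U1 \<inter> L = {}" "finite L"
  shows "in_sum (U1 \<union> L) F"
proof -
  let ?A = "\<lambda>x y. F x y v"
  have "bilinear ?A"
    unfolding bilinear_def using F_lin[OF F] by blast
  then have l: "lift ?A \<in> F_space f v h" by (rule lift_F_space) (rule F_v_v[OF F])
  have "in_sum U1 (\<lambda>x y z. F x y z - lift ?A x y z)"
    by (rule vertical_zero_in_sum[OF F_space_diff[OF F l]]) (simp add: lift_def F_v_v[OF F])
  then show ?thesis by (rule in_sum_union[OF _ L(1,2) _ L(3)]) (auto simp: U1_def)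
qed

text \<open>The three symmetry conditions on \<open>F(x, fy, v)\<close> are the cases \<open>c = 1\<close>, \<open>c = -1\<close> and \<open>c = 0\<close> of one
  linear condition, which sums inherit from their summands.\<close>

lemma in_sum_vertical:
  assumes "in_sum K F" "\<And>H k. H \<in> cls k \<Longrightarrow> k \<in> K \<Longrightarrow> H x (f y) v = c * H y (f x) v"
  shows "F x (f y) v = c * F y (f x) v"
proof -
  obtain G where "\<forall>k\<in>K. G k \<in> cls k" "\<forall>x y z. F x y z = (\<Sum>k\<in>K. G k x y z)"
    using assms(1) unfolding in_sum_def by blast
  then show ?thesis
    using assms(2) by (auto simp: sum_distrib_left intro!: sum.cong)
qed

lemma in_sum_symmetric_iff:
  assumes F: "F \<in> F_space f v h"
  shows "in_sum (U1 \<union> {C4, C5, C6, C9}) F \<longleftrightarrow> (\<forall>x y. F x (f y) v = F y (f x) v)"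
proof
  assume F': "in_sum (U1 \<union> {C4, C5, C6, C9}) F"
  have "F x (f y) v = 1 * F y (f x) v" for x y
  proof (rule in_sum_vertical[OF F'])
    fix H k
    assume H: "H \<in> cls k" and k: "k \<in> U1 \<union> {C4, C5, C6, C9}"
    show "H x (f y) v = 1 * H y (f x) v"
    proof (cases "k \<in> U1")
      case True
      then show ?thesis by (simp add: class_vertical_zero[OF H])
    next
      case False
      then show ?thesis using class_vertical_symmetric[OF H, of x y] k by simp
    qed
  qed
  then show "\<forall>x y. F x (f y) v = F y (f x) v" by simp
next
  assume *: "\<forall>x y. F x (f y) v = F y (f x) v"
  have "in_sum {C4, C5, C6, C9} (lift (\<lambda>x y. F x y v))"
  proof (rule lift_symmetric)
    show "bilinear (\<lambda>x y. F x y v)" using F_lin[OF F] by (simp add: bilinear_def)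
  qed (rule F_v_v[OF F], rule *[rule_format])
  then show "in_sum (U1 \<union> {C4, C5, C6, C9}) F"
    by (rule in_sum_split[OF F]) (auto simp: U1_def)
qed

lemma in_sum_skew_iff:
  assumes F: "F \<in> F_space f v h"
  shows "in_sum (U1 \<union> {C7, C8}) F \<longleftrightarrow> (\<forall>x y. F x (f y) v = - F y (f x) v)"
proof
  assume F': "in_sum (U1 \<union> {C7, C8}) F"
  have eq: "F x (f y) v = -1 * F y (f x) v" for x y
  proof (rule in_sum_vertical[OF F'])
    fix H k
    assume H: "H \<in> cls k" and k: "k \<in> U1 \<union> {C7, C8}"
    show "H x (f y) v = -1 * H y (f x) v"
    proof (cases "k \<in> U1")
      case True
      then show ?thesis by (simp add: class_vertical_zero[OF H])
    next
      case False
      then show ?thesis using class_vertical_skew[OF H, of x y] k by simp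
    qed
  qed
  show "\<forall>x y. F x (f y) v = - F y (f x) v" by (intro allI) (rule eq[unfolded mult_minus1])
next
  assume *: "\<forall>x y. F x (f y) v = - F y (f x) v"
  have "in_sum {C7, C8} (lift (\<lambda>x y. F x y v))"
  proof (rule lift_skew)
    show "bilinear (\<lambda>x y. F x y v)" using F_lin[OF F] by (simp add: bilinear_def)
  qed (rule F_v_v[OF F], rule *[rule_format])
  then show "in_sum (U1 \<union> {C7, C8}) F"
    by (rule in_sum_split[OF F]) (auto simp: U1_def)
qed

lemma in_sum_zero_iff:
  assumes F: "F \<in> F_space f v h"
  shows "in_sum U1 F \<longleftrightarrow> (\<forall>x y. F x (f y) v = 0)"
proof
  assume F': "in_sum U1 F"
  have "F x (f y) v = 0 * F y (f x) v" for x y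
    by (rule in_sum_vertical[OF F']) (simp add: class_vertical_zero)
  then show "\<forall>x y. F x (f y) v = 0" by simp
next
  assume *: "\<forall>x y. F x (f y) v = 0"
  have "F x y v = 0" for x y
    using *[rule_format, of x "f y"] by (simp add: f_f F_simps[OF F] F_v_v[OF F])
  then show "in_sum U1 F" by (rule vertical_zero_in_sum[OF F])
qed

end

section \<open>Smooth extension of tangent vectors\<close>

lemma Ck_on_constant:
  assumes "open S" "\<And>u. u \<in> S \<Longrightarrow> r u = c"
  shows "Ck_on k S r"
  using assms(2)
proof (induction k arbitrary: r c)
  case 0
  then show ?case by (simp add: continuous_on_eq[OF continuous_on_const, of S c r])
next
  case (Suc k)
  have der: "(r has_derivative (\<lambda>_. 0)) (at u)" if "u \<in> S" for u
    by (rule has_derivative_transform_within_open[OF has_derivative_const assms(1) that])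
      (simp add: Suc.prems)
  have "frechet_derivative r (at u) w = 0" if "u \<in> S" for u w
    using frechet_derivative_at[OF der[OF that]] by metis
  then have "Ck_on k S (\<lambda>u. frechet_derivative r (at u) w)" for w
    by (intro Suc.IH[of _ 0]) simp
  moreover have "\<forall>u\<in>S. r differentiable (at u)"
    using der differentiable_def by blast
  ultimately show ?case by simp
qed

lemma smooth_on_constant: "open S \<Longrightarrow> (\<And>u. u \<in> S \<Longrightarrow> r u = c) \<Longrightarrow> smooth_on S r"
  unfolding smooth_on_def using Ck_on_constant by blast

lemma frechet_derivative_local_id:
  assumes "open S" "a \<in> S" "\<And>u. u \<in> S \<Longrightarrow> F u = u"
  shows "frechet_derivative F (at a) = (\<lambda>u. u)"
proof -
  have "(F has_derivative (\<lambda>u. u)) (at a)"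
    by (rule has_derivative_transform_within_open[OF has_derivative_ident assms(1,2)])
      (simp add: assms(3))
  then show ?thesis by (metis frechet_derivative_at)
qed

context
  fixes A :: "('m::{t2_space,second_countable_topology}, 'e::euclidean_space) chart set"
  assumes A: "smooth_atlas A"
begin

lemma chart_at: "chart_at A p \<in> A" "p \<in> fst (chart_at A p)"
proof -
  have "p \<in> (\<Union>c\<in>A. fst c)" using A unfolding smooth_atlas_def by blast
  then have "\<exists>c. c \<in> A \<and> p \<in> fst c" by blast
  then show "chart_at A p \<in> A" "p \<in> fst (chart_at A p)"
    unfolding chart_at_def by (metis (mono_tags, lifting) someI_ex)+
qed

lemma chart_homeo:
  assumes "c \<in> A"
  shows "open (fst c)" "open (snd c ` fst c)"
    "homeomorphism (fst c) (snd c ` fst c) (snd c) (chart_inv c)"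
  using A assms unfolding smooth_atlas_def by blast+

lemma chart_inv_chart: "c \<in> A \<Longrightarrow> q \<in> fst c \<Longrightarrow> chart_inv c (snd c q) = q"
  using homeomorphism_apply1[OF chart_homeo(3)] .

lemma open_chart_image:
  assumes "c \<in> A" "open W" "W \<subseteq> fst c"
  shows "open (snd c ` W)"
  using homeomorphism_imp_open_map[OF chart_homeo(3)[OF assms(1)], of W] assms chart_homeo[OF assms(1)]
  by (metis openin_open_eq openin_open_trans open_subset)

lemma transition_differentiable:
  assumes "c \<in> A" "d \<in> A" "q \<in> fst c" "q \<in> fst d"
  shows "(snd d \<circ> chart_inv c) differentiable (at (snd c q))"
proof -
  have "smooth_on (snd c ` (fst c \<inter> fst d)) (snd d \<circ> chart_inv c)"
    using A assms(1,2) unfolding smooth_atlas_def by blast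
  then have "Ck_on (Suc 0) (snd c ` (fst c \<inter> fst d)) (snd d \<circ> chart_inv c)"
    unfolding smooth_on_def by blast
  then show ?thesis using assms(3,4) by simp
qed

text \<open>Differentiate the identity \<open>c \<circ> d\<^sup>-\<^sup>1 \<circ> d \<circ> c\<^sup>-\<^sup>1 = id\<close>, which holds on the open coordinate image of
  the overlap of the charts.\<close>

lemma coord_change_inverse:
  assumes "c \<in> A" "d \<in> A" "q \<in> fst c" "q \<in> fst d"
  shows "coord_change d c q (coord_change c d q y) = y"
proof -
  let ?a = "snd c q"
  have q: "chart_inv c ?a = q" by (rule chart_inv_chart[OF assms(1,3)])
  have "frechet_derivative ((snd c \<circ> chart_inv d) \<circ> (snd d \<circ> chart_inv c)) (at ?a)
      = frechet_derivative (snd c \<circ> chart_inv d) (at ((snd d \<circ> chart_inv c) ?a))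
        \<circ> frechet_derivative (snd d \<circ> chart_inv c) (at ?a)"
    by (rule frechet_derivative_compose)
      (use transition_differentiable[OF assms] transition_differentiable[OF assms(2,1,4,3)] q in simp_all)
  moreover have "frechet_derivative ((snd c \<circ> chart_inv d) \<circ> (snd d \<circ> chart_inv c)) (at ?a)
      = (\<lambda>u. u)"
  proof (rule frechet_derivative_local_id)
    show "open (snd c ` (fst c \<inter> fst d))"
      using assms(1,2) by (intro open_chart_image open_Int chart_homeo) auto
    show "?a \<in> snd c ` (fst c \<inter> fst d)" using assms(3,4) by blast
    show "((snd c \<circ> chart_inv d) \<circ> (snd d \<circ> chart_inv c)) u = u"
      if "u \<in> snd c ` (fst c \<inter> fst d)" for u
      using that assms(1,2) by (auto simp: chart_inv_chart)
  qed
  ultimately show ?thesis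
    unfolding coord_change_def using q by (metis comp_apply)
qed

lemma coord_field_at [simp]: "coord_field A p y p = y"
proof -
  let ?c = "chart_at A p"
  have "frechet_derivative (snd ?c \<circ> chart_inv ?c) (at (snd ?c p)) = (\<lambda>u. u)"
  proof (rule frechet_derivative_local_id)
    show "open (snd ?c ` fst ?c)" by (rule chart_homeo(2)[OF chart_at(1)])
    show "snd ?c p \<in> snd ?c ` fst ?c" using chart_at(2) by blast
  qed (auto simp: chart_inv_chart chart_at)
  then show ?thesis by (simp add: coord_field_def coord_change_def)
qed

text \<open>In the chart selected at \<open>p\<close> the components of this field are constant.\<close>

lemma smooth_coord_field: "smooth_vec_at A p (coord_field A p y)"
  unfolding smooth_vec_at_def smooth_near_def
proof (intro exI conjI)
  let ?c = "chart_at A p"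
  show op: "open (snd ?c ` fst ?c)" by (rule chart_homeo(2)[OF chart_at(1)])
  show "snd ?c p \<in> snd ?c ` fst ?c" using chart_at(2) by blast
  show "smooth_on (snd ?c ` fst ?c) (vec_rep A p (coord_field A p y))"
  proof (rule smooth_on_constant[OF op])
    fix u assume "u \<in> snd ?c ` fst ?c"
    then show "vec_rep A p (coord_field A p y) u = y"
      by (auto simp: vec_rep_def coord_field_def Let_def chart_inv_chart chart_at
          coord_change_inverse)
  qed
qed simp

lemma smooth_fun_const: "smooth_fun_at A p (\<lambda>_. c)"
  unfolding smooth_fun_at_def smooth_near_def
  using chart_homeo(2)[OF chart_at(1)] chart_at(2)
  by (intro exI[of _ "snd (chart_at A p) ` fst (chart_at A p)"])
    (auto intro!: smooth_on_constant simp: fun_rep_def)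

end

lemma vderiv_const: "vderiv A p x (\<lambda>_. c) = 0"
  by (simp add: vderiv_def fun_rep_def o_def)

section \<open>The covariant derivative of the characteristic vector field\<close>

lemma all_equivalentI: "list_all (\<lambda>Q. Q \<longleftrightarrow> R) Qs \<Longrightarrow> all_equivalent Qs"
  by (auto simp: all_equivalent_def list_all_iff)

locale acb_levi_civita =
  fixes n :: nat
    and M :: "('m::{t2_space,second_countable_topology}, 'e::euclidean_space) acb_structure"
    and nab :: "('m, 'e) connection"
  assumes n_pos: "n \<ge> 1" and acb: "acb_manifold n M" and lc: "levi_civita M nab"

sublocale acb_levi_civita \<subseteq> pt: acb_space n "phi M p" "xi M p" "eta M p" "gtensor M p" for p
  using n_pos acb unfolding acb_manifold_def by (intro acb_space.intro) iprover+

context acb_levi_civita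
begin

abbreviation smooth :: "'m \<Rightarrow> ('m \<Rightarrow> 'e) \<Rightarrow> bool" where
  "smooth \<equiv> smooth_vec_at (atlas M)"

abbreviation ext :: "'m \<Rightarrow> 'e \<Rightarrow> 'm \<Rightarrow> 'e" where
  "ext \<equiv> coord_field (atlas M)"

lemma atlas: "smooth_atlas (atlas M)"
  using acb by (simp add: acb_manifold_def)

lemmas ext_at [simp] = coord_field_at[OF atlas]
  and smooth_ext [simp] = smooth_coord_field[OF atlas]

lemma smooth_phi [simp]: "smooth p X \<Longrightarrow> smooth p (\<lambda>q. phi M q (X q))"
  and smooth_xi [simp]: "smooth p (xi M)"
  and smooth_eta: "smooth p X \<Longrightarrow> smooth_fun_at (atlas M) p (\<lambda>q. eta M q (X q))"
  using acb by (simp_all add: acb_manifold_def)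

lemma affine: "affine_connection (atlas M) nab"
  using lc by (simp add: levi_civita_def)

lemma linear_nab: "smooth p Y \<Longrightarrow> linear (\<lambda>x. nab p x Y)"
  and nab_add: "smooth p Y \<Longrightarrow> smooth p Z \<Longrightarrow>
        nab p x (\<lambda>q. Y q + Z q) = nab p x Y + nab p x Z"
  and nab_scale: "smooth_fun_at (atlas M) p u \<Longrightarrow> smooth p Y \<Longrightarrow>
        nab p x (\<lambda>q. u q *\<^sub>R Y q) = vderiv (atlas M) p x u *\<^sub>R Y p + u p *\<^sub>R nab p x Y"
  using affine unfolding affine_connection_def by blast+

lemma torsion_free: "smooth p X \<Longrightarrow> smooth p Y \<Longrightarrow>
        nab p (X p) Y - nab p (Y p) X = lie_bracket (atlas M) X Y p"
  and metric: "smooth p Y \<Longrightarrow> smooth p Z \<Longrightarrow>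
        vderiv (atlas M) p x (\<lambda>q. gtensor M q (Y q) (Z q)) =
          gtensor M p (nab p x Y) (Z p) + gtensor M p (Y p) (nab p x Z)"
  using lc unfolding levi_civita_def by blast+

lemma nab_neg: "smooth p Y \<Longrightarrow> nab p x (\<lambda>q. - Y q) = - nab p x Y"
  using nab_scale[OF smooth_fun_const[OF atlas, of p "-1"], of Y x] by (simp add: vderiv_const)

lemma eta_nab_xi [simp]: "eta M p (nab p x (xi M)) = 0"
  using metric[OF smooth_xi smooth_xi, of p x] by (simp add: vderiv_const)

text \<open>The form \<open>\<beta>\<close> to which all conditions of the theorem reduce.\<close>

definition nab_xi :: "'m \<Rightarrow> 'e \<Rightarrow> 'e \<Rightarrow> real" where
  "nab_xi p x y = gtensor M p (nab p x (xi M)) y"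

lemma nab_xi_lin: "linear (nab_xi p x)"
  unfolding nab_xi_def using pt.lin_g by simp

lemma nabla_eta_eq:
  assumes "smooth p Y"
  shows "nabla_eta M nab p X Y = nab_xi p (X p) (Y p)"
  using metric[OF assms smooth_xi, of "X p"]
  by (simp add: nabla_eta_def nab_xi_def pt.g_sym)

lemma d_eta_eq:
  assumes "smooth p X" "smooth p Y"
  shows "d_eta M p X Y = nab_xi p (X p) (Y p) - nab_xi p (Y p) (X p)"
  unfolding d_eta_def torsion_free[OF assms, symmetric]
  using nabla_eta_eq[OF assms(1), of Y] nabla_eta_eq[OF assms(2), of X]
  by (simp add: nabla_eta_def)

lemma lie_xi_metric_eq:
  assumes "smooth p X" "smooth p Y"
  shows "lie_xi_metric M p X Y = nab_xi p (X p) (Y p) + nab_xi p (Y p) (X p)"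
  unfolding lie_xi_metric_def torsion_free[OF smooth_xi assms(1), symmetric]
    torsion_free[OF smooth_xi assms(2), symmetric]
  using metric[OF assms, of "xi M p"] by (simp add: nab_xi_def pt.g_sym)

lemma shape_form_eq: "shape_form M nab p x y = - nab_xi p x y"
  by (simp add: shape_form_def shape_def nab_xi_def)

lemma nab_ver:
  assumes Y: "smooth p Y"
  shows "nab p x (\<lambda>q. ver M q (Y q))
    = (nab_xi p x (Y p) + eta M p (nab p x Y)) *\<^sub>R xi M p + eta M p (Y p) *\<^sub>R nab p x (xi M)"
proof -
  have "vderiv (atlas M) p x (\<lambda>q. eta M q (Y q)) = nab_xi p x (Y p) + eta M p (nab p x Y)"
    using nabla_eta_eq[OF Y, of "\<lambda>_. x"] by (simp add: nabla_eta_def)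
  then show ?thesis
    using nab_scale[OF smooth_eta[OF Y] smooth_xi, of x] by (simp add: ver_def)
qed

text \<open>The vertical part of \<open>Y\<close> is \<open>\<phi>\<^sup>2 Y + Y\<close> and the horizontal part is \<open>-\<phi>\<^sup>2 Y\<close>. Written like this,
  smoothness of the two parts follows from the smoothness of \<open>\<phi>\<close>, and their covariant derivatives
  from additivity.\<close>

lemma nab_phi_phi:
  assumes Y: "smooth p Y"
  shows "nab p x (\<lambda>q. phi M q (phi M q (Y q))) = nab p x (\<lambda>q. ver M q (Y q)) - nab p x Y"
proof -
  let ?W = "\<lambda>q. phi M q (phi M q (Y q))"
  have "(\<lambda>q. ver M q (Y q)) = (\<lambda>q. ?W q + Y q)" by (simp add: ver_def pt.f_f)
  moreover have "smooth p ?W" by (intro smooth_phi Y)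
  ultimately show ?thesis using nab_add[OF _ Y] by simp
qed

lemma nab_hor:
  assumes Y: "smooth p Y"
  shows "nab p x (\<lambda>q. hor M q (Y q)) = nab p x Y - nab p x (\<lambda>q. ver M q (Y q))"
proof -
  let ?W = "\<lambda>q. phi M q (phi M q (Y q))"
  have "(\<lambda>q. hor M q (Y q)) = (\<lambda>q. - ?W q)" by (simp add: hor_def pt.f_f)
  moreover have "smooth p ?W" by (intro smooth_phi Y)
  ultimately show ?thesis using nab_neg[of p ?W x] nab_phi_phi[OF Y] by simp
qed

text \<open>The formula \<open>D\<^sub>x Y - \<nabla>\<^sub>x Y = -\<eta>(Y) \<nabla>\<^sub>x\<xi> + (\<nabla>\<^sub>x\<eta>)(Y) \<xi>\<close> for the potential.\<close>

lemma svk_eq: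
  assumes Y: "smooth p Y"
  shows "svk_connection M nab p x Y
    = nab p x Y + nab_xi p x (Y p) *\<^sub>R xi M p - eta M p (Y p) *\<^sub>R nab p x (xi M)"
  unfolding svk_connection_def nab_hor[OF Y] nab_ver[OF Y]
  by (simp add: hor_def ver_def algebra_simps)

lemma svk_potential_ver_eq:
  assumes "smooth p Y"
  shows "svk_potential_ver M nab p X Y = nab_xi p (X p) (Y p) *\<^sub>R xi M p"
  by (simp add: svk_potential_ver_def svk_potential_def svk_eq[OF assms] ver_def)

lemma svk_torsion_ver_eq:
  assumes "smooth p X" "smooth p Y"
  shows "svk_torsion_ver M nab p X Y = (nab_xi p (X p) (Y p) - nab_xi p (Y p) (X p)) *\<^sub>R xi M p"
  by (simp add: svk_torsion_ver_def svk_torsion_def svk_eq assms ver_def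
      torsion_free[OF assms, symmetric])

lemma xi_nonzero: "xi M p \<noteq> 0"
  using pt.h_v[of p] by fastforce

text \<open>Since \<open>\<phi>\<close> is self-adjoint, both \<open>g(\<phi>Y, Z)\<close> and \<open>g(Y, \<phi>Z)\<close> denote the same function; compare
  its derivatives.\<close>

lemma nabla_phi_sym:
  assumes "smooth p Y" "smooth p Z"
  shows "gtensor M p (nabla_phi M nab p x Y) (Z p) = gtensor M p (nabla_phi M nab p x Z) (Y p)"
  using metric[OF smooth_phi[OF assms(1)] assms(2), of x]
    metric[OF assms(1) smooth_phi[OF assms(2)], of x]
  by (simp add: nabla_phi_def pt.g_f_left pt.g_sym[of p "Y p"])

text \<open>Tensoriality without coordinates: \<open>g((\<nabla>\<^sub>x\<phi>)Y, Z)\<close> depends on \<open>Z\<close> only through its value at \<open>p\<close>, and by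
  symmetry the same holds for \<open>Y\<close>.\<close>

lemma F_tensor_eq:
  assumes "smooth p Y"
  shows "F_tensor M nab p x (Y p) z = gtensor M p (nabla_phi M nab p x Y) z"
  using nabla_phi_sym[OF smooth_ext smooth_ext, of p x "Y p" z]
    nabla_phi_sym[OF smooth_ext assms, of x z]
  by (simp add: F_tensor_def)

lemma F_tensor_sym: "F_tensor M nab p x y z = F_tensor M nab p x z y"
  using nabla_phi_sym[OF smooth_ext smooth_ext, of p x y z] by (simp add: F_tensor_def)

lemma nab_zero: "nab p x (\<lambda>_. 0) = 0"
proof -
  (* The zero field is phi xi. *)
  have z: "smooth p (\<lambda>_. 0)" using smooth_phi[OF smooth_xi] by simp
  show ?thesis using nab_add[OF z z, of x] by simp
qed

lemma F_tensor_xi: "F_tensor M nab p x y (xi M p) = - nab_xi p x (phi M p y)"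
  using F_tensor_eq[OF smooth_xi, of p x y]
  by (simp add: F_tensor_sym[of p x y] nabla_phi_def nab_zero nab_xi_def pt.g_f_left)

text \<open>The bridge between the classes and the covariant derivative of \<open>\<xi>\<close>.\<close>

lemma F_tensor_phi_xi: "F_tensor M nab p x (phi M p y) (xi M p) = nab_xi p x y"
  by (simp add: F_tensor_xi pt.f_f linear_diff[OF nab_xi_lin] linear_add[OF nab_xi_lin]
      linear_neg[OF nab_xi_lin] linear_scale[OF nab_xi_lin])
    (simp add: nab_xi_def)

text \<open>Differentiate \<open>\<phi>\<^sup>2 = -Id + \<eta> \<otimes> \<xi>\<close> by the product rule.\<close>

lemma nabla_phi_phi:
  assumes "smooth p Y"
  shows "nabla_phi M nab p x (\<lambda>q. phi M q (Y q)) + phi M p (nabla_phi M nab p x Y)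
    = nab_xi p x (Y p) *\<^sub>R xi M p + eta M p (Y p) *\<^sub>R nab p x (xi M)"
  using nab_phi_phi[OF assms, of x]
  by (simp add: nabla_phi_def nab_ver[OF assms] pt.f_f[of p "nab p x Y"] algebra_simps)

text \<open>The identity for \<open>F(x, \<phi>y, \<phi>z)\<close> comes from the derivative of \<open>\<phi>\<^sup>2\<close>; the terms with \<open>\<nabla>\<^sub>x\<xi>\<close> turn into
  values of \<open>F\<close> on \<open>\<xi>\<close>.\<close>

lemma F_tensor_F_space: "F_tensor M nab p \<in> F_space (phi M p) (xi M p) (eta M p)"
proof (rule pt.F_spaceI)
  fix x y z
  have "F_tensor M nab p x (phi M p y) (phi M p z)
      = gtensor M p (nabla_phi M nab p x (\<lambda>q. phi M q (ext p y q))) (phi M p z)"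
    using F_tensor_eq[OF smooth_phi[OF smooth_ext[of p y]], of x] by simp
  also have "\<dots> = gtensor M p (nab_xi p x y *\<^sub>R xi M p + eta M p y *\<^sub>R nab p x (xi M)
      - phi M p (nabla_phi M nab p x (ext p y))) (phi M p z)"
    using nabla_phi_phi[OF smooth_ext[of p y], of x] by (simp only: eq_diff_eq[symmetric] ext_at)
  also have "\<dots> = eta M p y * nab_xi p x (phi M p z) + F_tensor M nab p x y z
      - eta M p (nabla_phi M nab p x (ext p y)) * eta M p z"
    by (simp add: nab_xi_def F_tensor_def pt.g_f_f)
  also have "eta M p (nabla_phi M nab p x (ext p y)) = F_tensor M nab p x y (xi M p)"
    by (simp add: F_tensor_def)
  finally show "F_tensor M nab p x y z = F_tensor M nab p x (phi M p y) (phi M p z)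
      + eta M p y * F_tensor M nab p x (xi M p) z + eta M p z * F_tensor M nab p x y (xi M p)"
    by (simp add: F_tensor_sym[of p x "xi M p" z] F_tensor_xi algebra_simps)
next
  have lin: "linear (\<lambda>x. nabla_phi M nab p x (ext p y))" for y
    unfolding nabla_phi_def
    by (intro linear_compose_sub linear_nab smooth_phi smooth_ext
        linear_compose[OF linear_nab pt.lin_f, unfolded o_def])
  show "F_tensor M nab p (x + x') y z = F_tensor M nab p x y z + F_tensor M nab p x' y z" for x x' y z
    by (simp add: F_tensor_def linear_add[OF lin])
  show "F_tensor M nab p (c *\<^sub>R x) y z = c * F_tensor M nab p x y z" for c x y z
    by (simp add: F_tensor_def linear_scale[OF lin])
qed (rule F_tensor_sym | simp add: F_tensor_def)+

lemma in_classes_eq: "in_classes n M nab K \<longleftrightarrow> (\<forall>p. pt.in_sum p K (F_tensor M nab p))"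
  by (simp add: in_classes_def pt.in_sum_def)

text \<open>A condition on the values of vector fields is a condition on tangent vectors, because every
  tangent vector extends to a smooth field.\<close>

lemma fields_iff:
  assumes "\<And>p X Y. smooth p X \<Longrightarrow> smooth p Y \<Longrightarrow> P p X Y \<longleftrightarrow> R p (X p) (Y p)"
  shows "(\<forall>p X Y. smooth p X \<longrightarrow> smooth p Y \<longrightarrow> P p X Y) \<longleftrightarrow> (\<forall>p x y. R p x y)"
  using assms smooth_ext ext_at by metis

lemma nab_xi_zero_iff: "(\<forall>y. nab_xi p x y = 0) \<longleftrightarrow> nab p x (xi M) = 0"
  using pt.nondegenerate[of p "nab p x (xi M)"] by (auto simp: nab_xi_def)

section \<open>The three equivalences\<close>

lemma nabla_eta_symmetric_iff:
  "sym_field M (nabla_eta M nab) \<longleftrightarrow> (\<forall>p x y. nab_xi p x y = nab_xi p y x)"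
  unfolding sym_field_def by (rule fields_iff) (simp add: nabla_eta_eq)

lemma d_eta_zero_iff: "zero_field M (d_eta M) \<longleftrightarrow> (\<forall>p x y. nab_xi p x y = nab_xi p y x)"
  unfolding zero_field_def by (rule fields_iff) (simp add: d_eta_eq)

lemma lie_xi_metric_zero_iff:
  "zero_field M (lie_xi_metric M) \<longleftrightarrow> (\<forall>p x y. nab_xi p x y = - nab_xi p y x)"
  unfolding zero_field_def by (rule fields_iff) (simp add: lie_xi_metric_eq eq_neg_iff_add_eq_0)

lemma symmetric_case:
  "all_equivalent
      [sym_field M (nabla_eta M nab),
       zero_field M (d_eta M),
       sym_field M (svk_potential_ver M nab),
       zero_field M (svk_torsion_ver M nab),
       \<forall>p x y. gtensor M p (shape M nab p x) y = gtensor M p x (shape M nab p y),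
       \<forall>p x y. shape_form M nab p x y = shape_form M nab p y x,
       in_classes n M nab (U1 \<union> {C4, C5, C6, C9})]"
proof (rule all_equivalentI, unfold list.pred_inject, intro conjI)
  let ?R = "\<forall>p x y. nab_xi p x y = nab_xi p y x"
  show "sym_field M (nabla_eta M nab) \<longleftrightarrow> ?R" by (rule nabla_eta_symmetric_iff)
  show "zero_field M (d_eta M) \<longleftrightarrow> ?R" by (rule d_eta_zero_iff)
  show "sym_field M (svk_potential_ver M nab) \<longleftrightarrow> ?R"
    unfolding sym_field_def by (rule fields_iff) (simp add: svk_potential_ver_eq xi_nonzero)
  show "zero_field M (svk_torsion_ver M nab) \<longleftrightarrow> ?R"
    unfolding zero_field_def by (rule fields_iff) (simp add: svk_torsion_ver_eq xi_nonzero)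
  show "(\<forall>p x y. gtensor M p (shape M nab p x) y = gtensor M p x (shape M nab p y)) \<longleftrightarrow> ?R"
    by (simp add: shape_def nab_xi_def pt.g_sym[of _ _ "nab _ _ _"])
  show "(\<forall>p x y. shape_form M nab p x y = shape_form M nab p y x) \<longleftrightarrow> ?R"
    by (simp add: shape_form_eq)
  show "in_classes n M nab (U1 \<union> {C4, C5, C6, C9}) \<longleftrightarrow> ?R"
    by (simp only: in_classes_eq pt.in_sum_symmetric_iff[OF F_tensor_F_space] F_tensor_phi_xi)
qed simp

lemma skew_case:
  "all_equivalent
      [skew_field M (nabla_eta M nab),
       zero_field M (lie_xi_metric M),
       skew_field M (svk_potential_ver M nab),
       \<forall>p x y. gtensor M p (shape M nab p x) y = - gtensor M p x (shape M nab p y),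
       \<forall>p x y. shape_form M nab p x y = - shape_form M nab p y x,
       in_classes n M nab (U1 \<union> {C7, C8})]"
proof (rule all_equivalentI, unfold list.pred_inject, intro conjI)
  let ?R = "\<forall>p x y. nab_xi p x y = - nab_xi p y x"
  have scale: "a *\<^sub>R xi M p = - (b *\<^sub>R xi M p) \<longleftrightarrow> a = - b" for a b p
    using scaleR_cancel_right[of a "xi M p" "- b"] by (simp add: xi_nonzero)
  show "skew_field M (nabla_eta M nab) \<longleftrightarrow> ?R"
    unfolding skew_field_def by (rule fields_iff) (simp only: nabla_eta_eq)
  show "zero_field M (lie_xi_metric M) \<longleftrightarrow> ?R" by (rule lie_xi_metric_zero_iff)
  show "skew_field M (svk_potential_ver M nab) \<longleftrightarrow> ?R"
    unfolding skew_field_def by (rule fields_iff) (simp only: svk_potential_ver_eq scale)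
  have "gtensor M p (shape M nab p x) y = - gtensor M p x (shape M nab p y)
      \<longleftrightarrow> nab_xi p x y = - nab_xi p y x" for p x y
    using pt.g_sym[of p x "nab p y (xi M)"] by (auto simp: shape_def nab_xi_def)
  then show "(\<forall>p x y. gtensor M p (shape M nab p x) y = - gtensor M p x (shape M nab p y)) \<longleftrightarrow> ?R"
    by (simp only:)
  have "shape_form M nab p x y = - shape_form M nab p y x \<longleftrightarrow> nab_xi p x y = - nab_xi p y x" for p x y
    by (simp only: shape_form_eq neg_equal_iff_equal)
  then show "(\<forall>p x y. shape_form M nab p x y = - shape_form M nab p y x) \<longleftrightarrow> ?R"
    by (simp only:)
  show "in_classes n M nab (U1 \<union> {C7, C8}) \<longleftrightarrow> ?R"
    by (simp only: in_classes_eq pt.in_sum_skew_iff[OF F_tensor_F_space] F_tensor_phi_xi)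
qed simp

lemma parallel_case:
  "all_equivalent
      [zero_field M (nabla_eta M nab),
       zero_field M (d_eta M) \<and> zero_field M (lie_xi_metric M),
       \<forall>p x. nab p x (xi M) = 0,
       \<forall>p x. shape M nab p x = 0,
       \<forall>p x y. shape_form M nab p x y = 0,
       \<forall>p x Y. smooth_vec_at (atlas M) p Y \<longrightarrow> svk_connection M nab p x Y = nab p x Y,
       in_classes n M nab U1]"
proof (rule all_equivalentI, unfold list.pred_inject, intro conjI)
  let ?R = "\<forall>p x y. nab_xi p x y = 0"
  show "zero_field M (nabla_eta M nab) \<longleftrightarrow> ?R"
    unfolding zero_field_def by (rule fields_iff) (simp add: nabla_eta_eq)
  have "a = b \<and> a = - b \<and> b = a \<and> b = - a \<longleftrightarrow> a = 0 \<and> b = 0" for a b :: real by auto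
  then show "zero_field M (d_eta M) \<and> zero_field M (lie_xi_metric M) \<longleftrightarrow> ?R"
    unfolding d_eta_zero_iff lie_xi_metric_zero_iff by metis
  show "(\<forall>p x. nab p x (xi M) = 0) \<longleftrightarrow> ?R"
    by (simp add: nab_xi_zero_iff)
  show "(\<forall>p x. shape M nab p x = 0) \<longleftrightarrow> ?R"
    by (simp add: nab_xi_zero_iff shape_def)
  show "(\<forall>p x y. shape_form M nab p x y = 0) \<longleftrightarrow> ?R"
    by (simp add: shape_form_eq)
  show "(\<forall>p x Y. smooth p Y \<longrightarrow> svk_connection M nab p x Y = nab p x Y) \<longleftrightarrow> ?R"
  proof
    assume "\<forall>p x Y. smooth p Y \<longrightarrow> svk_connection M nab p x Y = nab p x Y"
    (* On xi itself D - nabla reduces to - nabla xi, because (nabla_x eta)(xi) = 0. *)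
    then have "nab p x (xi M) = 0" for p x
      using svk_eq[OF smooth_xi, of p x] by (simp add: nab_xi_def)
    then show ?R by (simp add: nab_xi_def)
  next
    assume ?R
    then show "\<forall>p x Y. smooth p Y \<longrightarrow> svk_connection M nab p x Y = nab p x Y"
      using nab_xi_zero_iff by (simp add: svk_eq)
  qed
  show "in_classes n M nab U1 \<longleftrightarrow> ?R"
    by (simp only: in_classes_eq pt.in_sum_zero_iff[OF F_tensor_F_space] F_tensor_phi_xi)
qed simp

end

theorem theorem4p1:
  fixes n :: nat
    and M :: "('m::{t2_space,second_countable_topology}, 'e::euclidean_space) acb_structure"
    and nab :: "('m, 'e) connection"
  assumes "n \<ge> 1"
    and "acb_manifold n M"
    and "levi_civita M nab"
  shows "all_equivalent
      [sym_field M (nabla_eta M nab),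
       zero_field M (d_eta M),
       sym_field M (svk_potential_ver M nab),
       zero_field M (svk_torsion_ver M nab),
       \<forall>p x y. gtensor M p (shape M nab p x) y = gtensor M p x (shape M nab p y),
       \<forall>p x y. shape_form M nab p x y = shape_form M nab p y x,
       in_classes n M nab (U1 \<union> {C4, C5, C6, C9})]
    \<and> all_equivalent
      [skew_field M (nabla_eta M nab),
       zero_field M (lie_xi_metric M),
       skew_field M (svk_potential_ver M nab),
       \<forall>p x y. gtensor M p (shape M nab p x) y = - gtensor M p x (shape M nab p y),
       \<forall>p x y. shape_form M nab p x y = - shape_form M nab p y x,
       in_classes n M nab (U1 \<union> {C7, C8})]
    \<and> all_equivalent
      [zero_field M (nabla_eta M nab),
       zero_field M (d_eta M) \<and> zero_field M (lie_xi_metric M),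
       \<forall>p x. nab p x (xi M) = 0,
       \<forall>p x. shape M nab p x = 0,
       \<forall>p x y. shape_form M nab p x y = 0,
       \<forall>p x Y. smooth_vec_at (atlas M) p Y \<longrightarrow> svk_connection M nab p x Y = nab p x Y,
       in_classes n M nab U1]"
proof -
  interpret acb_levi_civita n M nab using assms by (rule acb_levi_civita.intro)
  show ?thesis by (intro conjI symmetric_case skew_case parallel_case)
qed

end
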